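(* Let $V$ be a connected braided vector space of diagonal type with basis $x_1,\dots,x_n$, $n>1$, and braiding matrix $(q_{ij})$. Assume that $\Delta(\mathfrak B(V))$ is an arithmetic root system, that there does not exist any $m$-infinity element in $\mathfrak B(V)$, and that $p_{uu}\neq 1$ for every $u\in D(V)$. Then: (i) $\dim\mathfrak B(V)=\infty$ if and only if there exists a braided vector space $V'$, twisting equivalent to $V$, such that $\dim\mathfrak L^-(V')=\infty$. (ii) If for every $1\le i\le n$ there exists $j\neq i$ such that $q_{ji}\neq 1$, then $\mathfrak B(V)$ is finite-dimensional if and only if $\mathfrak L^-(V)$ is finite-dimensional.
   Context: $F$ is a field of characteristic zero. $V$ has braiding of diagonal type $C(x_i\otimes x_j)=q_{ij}\,x_j\otimes x_i$, $q_{ij}\in F\setminus\{0\}$. $V$ is connected if the graph on $\{1,\dots,n\}$ with an edge between $i\neq j$ exactly when $q_{ij}q_{ji}\neq 1$ is connected. $\mathfrak B(V)$ is the Nichols algebra of $(V,C)$, i.e. the quotient of the tensor algebra $T(V)$ by the sum of the kernels of the quantum symmetrizers; it is $\mathbb N_0^n$-graded with $\deg x_i=e_i$. For homogeneous $u,v$ (or words in the $x_i$) of degrees $\alpha,\beta$ put $p_{uv}=\prod_{i,j}q_{ij}^{\alpha_i\beta_j}$. The braided bracket is $[x,y]=yx-p_{yx}xy$ for homogeneous $x,y$. $\mathfrak L^-(V)$ (the Nichols Lie algebra) is the Lie subalgebra generated by $V$ in the Lie algebra $\mathfrak B(V)^-$, i.e. $\mathfrak B(V)$ with commutator $[a,b]^-=ab-ba$.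 Two braided vector spaces of diagonal type of rank $n$ with matrices $(q_{ij})$, $(q'_{ij})$ are twisting equivalent if $q_{ii}=q'_{ii}$ and $q_{ij}q_{ji}=q'_{ij}q'_{ji}$ for all $i,j$. Hard super-letters (Kharchenko): order $x_1<\dots<x_n$ and words lexicographically ($u<v$ if $u$ is a proper prefix of $v$, or $u$ has the smaller letter at the first position of difference). A Lyndon word is a nonempty word that is smaller than each of its proper nonempty suffixes. For a Lyndon word $u$ define the super-letter $[u]$ by $[x_i]=x_i$ and $[u]=[[v],[w]]$ if $u=vw$ with $w$ the longest proper Lyndon suffix (brackets formed in $T(V)$, then taken in $\mathfrak B(V)$). Super-letters are ordered as their words. $[u]$ is hard if its value in $\mathfrak B(V)$ is not a linear combination of products, of the same degree, of super-letters all greater than $[u]$. $D=D(V)$ is the set of hard super-letters. The height $h_u$ of $[u]\in D$ is the least $h\ge1$ such that $[u]^h$ is a linear combination of products, of the same degree, of super-letters all greater than $[u]$, and $h_u=\infty$ if no such $h$ exists. $\mathrm{ord}(q)$ is the multiplicative order of $q$ (possibly $\infty$). If $[u]\in D$, $1<m=\mathrm{ord}(p_{uu})<\infty$ and $h_u=\infty$, then $[u]$ is called an $m$-infinity element. $\Delta^+(\mathfrak B(V))$ is the set of degrees of the elements of $D$, and $\Delta(\mathfrak B(V))=\Delta^+\cup(-\Delta^+)$. It is an arithmetic root system (Heckenberger) if the associated Weyl groupoid is full and finite; equivalently, if $\Delta(\mathfrak B(V))$ is finite. *)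

theory Defs
  imports
    "HOL-Library.Poly_Mapping"
    "HOL-Library.List_Lexorder"
    "HOL-Library.Sublist"
    "HOL-Library.Extended_Nat"
    "HOL-Combinatorics.Permutations"
    "HOL-Algebra.QuotRing"
    "HOL-Algebra.Embedded_Algebras"
begin

text \<open>
  A braided vector space of diagonal type of rank \<open>n\<close> over \<open>'a\<close> is given by its braiding matrix
  \<open>q :: 'n \<Rightarrow> 'n \<Rightarrow> 'a\<close>, where the finite type \<open>'n\<close> has \<open>n\<close> elements; the linear order on \<open>'n\<close> is
  the order of the basis vectors \<open>x\<^sub>i\<close>.
\<close>

section \<open>The tensor algebra\<close>

text \<open>
  \<open>T(V)\<close> is the monoid algebra of the free monoid \<open>'n list\<close>, so that multiplication is convolution
  along concatenation of words.
\<close>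

instantiation list :: (type) monoid_add
begin

definition zero_list :: "'a list" where "zero_list = []"

definition plus_list :: "'a list \<Rightarrow> 'a list \<Rightarrow> 'a list" where "plus_list = (@)"

instance by standard (simp_all add: zero_list_def plus_list_def)

end

type_synonym ('n, 'a) tensor = "'n list \<Rightarrow>\<^sub>0 'a"

definition word :: "'n list \<Rightarrow> ('n, 'a::field) tensor" where
  "word w = Poly_Mapping.single w 1"

definition tscale :: "'a::field \<Rightarrow> ('n, 'a) tensor \<Rightarrow> ('n, 'a) tensor" where
  "tscale c a = Poly_Mapping.single [] c * a"

interpretation tensor: vector_space "tscale :: 'a::field \<Rightarrow> ('n, 'a) tensor \<Rightarrow> ('n, 'a) tensor"
proof
  fix c d :: 'a and a b :: "('n, 'a) tensor"
  show "tscale c (a + b) = tscale c a + tscale c b"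
    by (simp add: tscale_def distrib_left)
  show "tscale (c + d) a = tscale c a + tscale d a"
    by (simp add: tscale_def distrib_right single_add)
  show "tscale c (tscale d a) = tscale (c * d) a"
    by (simp add: tscale_def mult.assoc [symmetric] mult_single plus_list_def)
  show "tscale 1 a = a"
    using single_one [where ?'a = "'n list" and ?'b = 'a] by (simp add: tscale_def zero_list_def)
qed

text \<open>The linear map on \<open>T(V)\<close> determined by its values on words.\<close>

definition linear_ext :: "('n list \<Rightarrow> ('n, 'a::field) tensor) \<Rightarrow> ('n, 'a) tensor \<Rightarrow> ('n, 'a) tensor" where
  "linear_ext f a = (\<Sum>w\<in>Poly_Mapping.keys a. tscale (Poly_Mapping.lookup a w) (f w))"

definition tensor_power :: "nat \<Rightarrow> ('n, 'a::field) tensor set" where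
  "tensor_power m = {a. \<forall>w\<in>Poly_Mapping.keys a. length w = m}"

section \<open>Quantum symmetrizers and the Nichols algebra\<close>

text \<open>
  The braiding applied to the tensor factors \<open>k\<close> and \<open>k + 1\<close> (counted from 0). Words with fewer
  than \<open>k + 2\<close> letters never matter and are mapped to 0.
\<close>

definition braiding_at ::
  "('n \<Rightarrow> 'n \<Rightarrow> 'a::field) \<Rightarrow> nat \<Rightarrow> ('n, 'a) tensor \<Rightarrow> ('n, 'a) tensor" where
  "braiding_at q k = linear_ext (\<lambda>w. if Suc k < length w
     then tscale (q (w ! k) (w ! Suc k)) (word (w[k := w ! Suc k, Suc k := w ! k])) else 0)"

text \<open>
  \<open>is_expression m ks \<sigma>\<close>: \<open>\<sigma> = s\<^sub>k s\<^sub>l \<dots>\<close> for \<open>ks = [k, l, \<dots>]\<close>, with \<open>s\<^sub>k\<close> the simple transpositions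
  of \<open>{..<m}\<close>.
\<close>

definition is_expression :: "nat \<Rightarrow> nat list \<Rightarrow> (nat \<Rightarrow> nat) \<Rightarrow> bool" where
  "is_expression m ks \<sigma> \<longleftrightarrow> (\<forall>k\<in>set ks. Suc k < m) \<and>
     \<sigma> = foldr (\<lambda>k \<tau>. transpose k (Suc k) \<circ> \<tau>) ks id"

definition reduced_expression :: "nat \<Rightarrow> (nat \<Rightarrow> nat) \<Rightarrow> nat list" where
  "reduced_expression m \<sigma> = (ARG_MIN length ks. is_expression m ks \<sigma>)"

text \<open>
  The Matsumoto lift of a permutation to the braid group, acting on the \<open>m\<close>-th tensor power.
  Since the braiding satisfies the braid equation, the choice of the reduced expression is immaterial.
\<close>

definition braid_lift ::
  "('n \<Rightarrow> 'n \<Rightarrow> 'a::field) \<Rightarrow> nat \<Rightarrow> (nat \<Rightarrow> nat) \<Rightarrow> ('n, 'a) tensor \<Rightarrow> ('n, 'a) tensor" where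
  "braid_lift q m \<sigma> = foldr (\<lambda>k f. braiding_at q k \<circ> f) (reduced_expression m \<sigma>) id"

definition quantum_symmetrizer ::
  "('n \<Rightarrow> 'n \<Rightarrow> 'a::field) \<Rightarrow> nat \<Rightarrow> ('n, 'a) tensor \<Rightarrow> ('n, 'a) tensor" where
  "quantum_symmetrizer q m a = (\<Sum>\<sigma> | \<sigma> permutes {..<m}. braid_lift q m \<sigma> a)"

definition nichols_ideal :: "('n \<Rightarrow> 'n \<Rightarrow> 'a::field) \<Rightarrow> ('n, 'a) tensor set" where
  "nichols_ideal q = tensor.span (\<Union>m. {a \<in> tensor_power m. quantum_symmetrizer q m a = 0})"

definition tensor_algebra :: "('n, 'a::field) tensor ring" where
  "tensor_algebra = \<lparr>carrier = UNIV, mult = (*), one = 1, zero = 0, add = (+)\<rparr>"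

definition nichols_algebra :: "('n \<Rightarrow> 'n \<Rightarrow> 'a::field) \<Rightarrow> ('n, 'a) tensor set ring" where
  "nichols_algebra q = tensor_algebra Quot nichols_ideal q"

definition to_nichols :: "('n \<Rightarrow> 'n \<Rightarrow> 'a::field) \<Rightarrow> ('n, 'a) tensor \<Rightarrow> ('n, 'a) tensor set" where
  "to_nichols q a = nichols_ideal q +>\<^bsub>tensor_algebra\<^esub> a"

text \<open>The copy \<open>F\<cdot>1\<close> of the ground field inside the Nichols algebra.\<close>

definition nichols_scalars :: "('n \<Rightarrow> 'n \<Rightarrow> 'a::field) \<Rightarrow> ('n, 'a) tensor set set" where
  "nichols_scalars q = {to_nichols q (tscale c 1) | c. True}"

text \<open>For a subspace \<open>E\<close> of the Nichols algebra; the dimension is that over the ground field.\<close>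

definition nichols_finite_dim ::
  "('n \<Rightarrow> 'n \<Rightarrow> 'a::field) \<Rightarrow> ('n, 'a) tensor set set \<Rightarrow> bool" where
  "nichols_finite_dim q E \<longleftrightarrow> ring.finite_dimension (nichols_algebra q) (nichols_scalars q) E"

section \<open>The Nichols Lie algebra\<close>

definition nichols_commutator ::
  "('n \<Rightarrow> 'n \<Rightarrow> 'a::field) \<Rightarrow> ('n, 'a) tensor set \<Rightarrow> ('n, 'a) tensor set \<Rightarrow> ('n, 'a) tensor set" where
  "nichols_commutator q a b =
     (a \<otimes>\<^bsub>nichols_algebra q\<^esub> b) \<ominus>\<^bsub>nichols_algebra q\<^esub> (b \<otimes>\<^bsub>nichols_algebra q\<^esub> a)"

text \<open>
  The library predicate \<^const>\<open>subalgebra\<close> does not involve products of elements of \<open>L\<close>: it says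
  that \<open>L\<close> is a linear subspace.
\<close>

definition nichols_lie :: "('n \<Rightarrow> 'n \<Rightarrow> 'a::field) \<Rightarrow> ('n, 'a) tensor set set" where
  "nichols_lie q = \<Inter>{L. subalgebra (nichols_scalars q) L (nichols_algebra q) \<and>
     (\<forall>i. to_nichols q (word [i]) \<in> L) \<and> (\<forall>a\<in>L. \<forall>b\<in>L. nichols_commutator q a b \<in> L)}"

section \<open>Connectedness and twisting equivalence\<close>

definition connected_braiding :: "('n \<Rightarrow> 'n \<Rightarrow> 'a::field) \<Rightarrow> bool" where
  "connected_braiding q \<longleftrightarrow> (\<forall>i j. (i, j) \<in> {(k, l). k \<noteq> l \<and> q k l * q l k \<noteq> 1}\<^sup>*)"

definition twisting_equivalent :: "('n \<Rightarrow> 'n \<Rightarrow> 'a::field) \<Rightarrow> ('n \<Rightarrow> 'n \<Rightarrow> 'a) \<Rightarrow> bool" where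
  "twisting_equivalent q q' \<longleftrightarrow>
     (\<forall>i. q i i = q' i i) \<and> (\<forall>i j. q i j * q j i = q' i j * q' j i)"

section \<open>Super-letters\<close>

text \<open>
  Degrees in \<open>\<nat>\<^sub>0\<^sup>n\<close> are functions \<open>'n \<Rightarrow> nat\<close>; the degree of a word \<open>u\<close> is \<^term>\<open>count_list u\<close>.
  \<open>bichar q \<alpha> \<beta>\<close> is \<open>p\<^sub>u\<^sub>v\<close> for \<open>u\<close>, \<open>v\<close> of degrees \<open>\<alpha>\<close>, \<open>\<beta>\<close>.
\<close>

definition bichar :: "('n::finite \<Rightarrow> 'n \<Rightarrow> 'a::field) \<Rightarrow> ('n \<Rightarrow> nat) \<Rightarrow> ('n \<Rightarrow> nat) \<Rightarrow> 'a" where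
  "bichar q \<alpha> \<beta> = (\<Prod>i\<in>UNIV. \<Prod>j\<in>UNIV. q i j ^ (\<alpha> i * \<beta> j))"

text \<open>\<open>[x, y] = y x - p\<^sub>y\<^sub>x x y\<close> for \<open>x\<close>, \<open>y\<close> homogeneous of degrees \<open>\<alpha>\<close>, \<open>\<beta>\<close>.\<close>

definition braided_bracket :: "('n::finite \<Rightarrow> 'n \<Rightarrow> 'a::field) \<Rightarrow>
    ('n \<Rightarrow> nat) \<Rightarrow> ('n, 'a) tensor \<Rightarrow> ('n \<Rightarrow> nat) \<Rightarrow> ('n, 'a) tensor \<Rightarrow> ('n, 'a) tensor" where
  "braided_bracket q \<alpha> x \<beta> y = y * x - tscale (bichar q \<beta> \<alpha>) (x * y)"

definition lyndon :: "'n::linorder list \<Rightarrow> bool" where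
  "lyndon u \<longleftrightarrow> u \<noteq> [] \<and> (\<forall>s. strict_suffix s u \<and> s \<noteq> [] \<longrightarrow> u < s)"

text \<open>\<open>drop (lyndon_split u) u\<close> is the longest proper Lyndon suffix of \<open>u\<close>, if \<open>u\<close> has two letters or more.\<close>

definition lyndon_split :: "'n::linorder list \<Rightarrow> nat" where
  "lyndon_split u = (LEAST k. 0 < k \<and> lyndon (drop k u))"

lemma lyndon_single: "lyndon [i]"
  by (auto simp: lyndon_def strict_suffix_def suffix_Cons)

lemma lyndon_split_bounds:
  assumes "2 \<le> length u"
  shows "0 < lyndon_split u" "lyndon_split u < length u"
proof -
  let ?P = "\<lambda>k. 0 < k \<and> lyndon (drop k u)"
  have "drop (length u - 1) u = [last u]"
    using assms by (cases u rule: rev_cases) auto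
  then have "?P (length u - 1)"
    using assms by (simp add: lyndon_single)
  then have "?P (lyndon_split u)"
    unfolding lyndon_split_def by (rule LeastI)
  then show "0 < lyndon_split u" "lyndon_split u < length u"
    by (auto simp: lyndon_def)
qed

text \<open>Only the values of \<open>super_letter q\<close> at Lyndon words are used.\<close>

function super_letter :: "('n::{finite,linorder} \<Rightarrow> 'n \<Rightarrow> 'a::field) \<Rightarrow> 'n list \<Rightarrow> ('n, 'a) tensor" where
  "super_letter q [] = 0"
| "super_letter q [i] = word [i]"
| "super_letter q (i # j # u) =
     (let k = lyndon_split (i # j # u); v = take k (i # j # u); w = drop k (i # j # u)
      in braided_bracket q (count_list v) (super_letter q v) (count_list w) (super_letter q w))"
  by pat_completeness auto
termination
proof (relation "measure (\<lambda>(q, u). length u)", goal_cases)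
  case 1
  show ?case by simp
next
  case (2 q i j u)
  then show ?case using lyndon_split_bounds [of "i # j # u"] by simp
next
  case (3 q i j u)
  then show ?case using lyndon_split_bounds [of "i # j # u"] by simp
qed

text \<open>
  The value of \<open>[v\<^sub>1] \<cdots> [v\<^sub>r]\<close> in \<open>T(V)\<close>, for super-letters \<open>[v\<^sub>i] > [u]\<close> of total degree \<open>\<alpha>\<close>.
\<close>

definition greater_products :: "('n::{finite,linorder} \<Rightarrow> 'n \<Rightarrow> 'a::field) \<Rightarrow>
    'n list \<Rightarrow> ('n \<Rightarrow> nat) \<Rightarrow> ('n, 'a) tensor set" where
  "greater_products q u \<alpha> = {prod_list (map (super_letter q) vs) | vs.
     (\<forall>v\<in>set vs. lyndon v \<and> u < v) \<and> count_list (concat vs) = \<alpha>}"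

text \<open>
  \<open>[u]\<^sup>h\<close> is, in the Nichols algebra, a linear combination of products, of the same degree, of
  super-letters greater than \<open>[u]\<close>.
\<close>

definition power_reducible ::
  "('n::{finite,linorder} \<Rightarrow> 'n \<Rightarrow> 'a::field) \<Rightarrow> 'n list \<Rightarrow> nat \<Rightarrow> bool" where
  "power_reducible q u h \<longleftrightarrow>
     (\<exists>a \<in> tensor.span (greater_products q u (\<lambda>i. h * count_list u i)).
        to_nichols q (super_letter q u ^ h) = to_nichols q a)"

text \<open>The set \<open>D(V)\<close>; a super-letter \<open>[u]\<close> is represented by its Lyndon word \<open>u\<close>.\<close>

definition hard_super_letters :: "('n::{finite,linorder} \<Rightarrow> 'n \<Rightarrow> 'a::field) \<Rightarrow> 'n list set" where
  "hard_super_letters q = {u. lyndon u \<and> \<not> power_reducible q u 1}"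

definition height :: "('n::{finite,linorder} \<Rightarrow> 'n \<Rightarrow> 'a::field) \<Rightarrow> 'n list \<Rightarrow> enat" where
  "height q u = (if \<exists>h\<ge>1. power_reducible q u h
     then enat (LEAST h. 1 \<le> h \<and> power_reducible q u h) else \<infinity>)"

definition mult_order :: "'a::field \<Rightarrow> enat" where
  "mult_order x = (if \<exists>k\<ge>1. x ^ k = 1 then enat (LEAST k. 1 \<le> k \<and> x ^ k = 1) else \<infinity>)"

definition self_braiding :: "('n::finite \<Rightarrow> 'n \<Rightarrow> 'a::field) \<Rightarrow> 'n list \<Rightarrow> 'a" where
  "self_braiding q u = bichar q (count_list u) (count_list u)"

definition infinity_element ::
  "('n::{finite,linorder} \<Rightarrow> 'n \<Rightarrow> 'a::field) \<Rightarrow> nat \<Rightarrow> 'n list \<Rightarrow> bool" where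
  "infinity_element q m u \<longleftrightarrow> u \<in> hard_super_letters q \<and> 1 < m \<and>
     mult_order (self_braiding q u) = enat m \<and> height q u = \<infinity>"

section \<open>Root systems\<close>

definition positive_roots :: "('n::{finite,linorder} \<Rightarrow> 'n \<Rightarrow> 'a::field) \<Rightarrow> ('n \<Rightarrow> int) set" where
  "positive_roots q = {(\<lambda>i. int (count_list u i)) | u. u \<in> hard_super_letters q}"

definition roots :: "('n::{finite,linorder} \<Rightarrow> 'n \<Rightarrow> 'a::field) \<Rightarrow> ('n \<Rightarrow> int) set" where
  "roots q = positive_roots q \<union> {(\<lambda>i. - \<alpha> i) | \<alpha>. \<alpha> \<in> positive_roots q}"

text \<open>Heckenberger: the Weyl groupoid is full and finite if and only if this holds.\<close>

definition arithmetic_root_system :: "('n::{finite,linorder} \<Rightarrow> 'n \<Rightarrow> 'a::field) \<Rightarrow> bool" where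
  "arithmetic_root_system q \<longleftrightarrow> finite (roots q)"

end

theory Submission
  imports Defs "HOL-Combinatorics.Multiset_Permutations"
begin

text \<open>
  For connected \<open>V\<close> of rank at least 2 in characteristic zero, \<open>\<BB>(V)\<close> is finite-dimensional if and only if
  \<open>\<LL>\<^sup>-(V)\<close> is. Let \<open>\<LL>\<^sup>-(V)\<close> be finite-dimensional; then all long iterated commutators of the \<open>x\<^sub>i\<close> vanish.

  Each \<open>x\<^sub>i\<close> is nilpotent: connectedness gives \<open>j \<noteq> i\<close> with \<open>q\<^sub>i\<^sub>j \<noteq> 1\<close> or \<open>q\<^sub>j\<^sub>i \<noteq> 1\<close>, and a coefficient of the
  quantum symmetrizer at \<open>(ad x\<^sub>i)\<^sup>k(x\<^sub>j)\<close> is \<open>(q\<^sub>i\<^sub>j - 1)\<^sup>k\<close>, another one \<open>(1 - q\<^sub>j\<^sub>i)\<^sup>k\<close>, times the quantum factorial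
  by which the symmetrizer multiplies \<open>x\<^sub>i\<^sup>k\<close>.

  The iterated commutators of maximal length are then central, and \<open>z = [x\<^sub>i, y]\<close> is nilpotent because \<open>ad y\<close> is a
  derivation with \<open>x\<^sub>i \<mapsto> \<plusminus>z\<close>, so that its \<open>m\<close>-th power maps \<open>x\<^sub>i\<^sup>m = 0\<close> to \<open>\<plusminus>m! z\<^sup>m\<close>. They generate a nilpotent
  ideal; dividing it out and iterating shows that the augmentation ideal of \<open>\<BB>(V)\<close> is nilpotent.

  Twisting equivalent braidings have conjugate quantum symmetrizers, which transfers finite-dimensionality
  from \<open>\<BB>(V)\<close> to \<open>\<BB>(V')\<close>.
\<close>

section \<open>Linear maps on the tensor algebra\<close>

interpretation tensor_pair: vector_space_pair
  "tscale :: 'a::field \<Rightarrow> ('n, 'a) tensor \<Rightarrow> ('n, 'a) tensor"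
  "tscale :: 'a::field \<Rightarrow> ('m, 'a) tensor \<Rightarrow> ('m, 'a) tensor" ..

abbreviation tlinear :: "(('n, 'a::field) tensor \<Rightarrow> ('m, 'a) tensor) \<Rightarrow> bool" where
  "tlinear \<equiv> Vector_Spaces.linear tscale tscale"

lemma tlinearI:
  assumes "\<And>a b. f (a + b) = f a + f b" "\<And>c a. f (tscale c a) = tscale c (f a)"
  shows "tlinear f"
  using assms by unfold_locales auto

lemma lookup_tscale [simp]: "Poly_Mapping.lookup (tscale c a) w = c * Poly_Mapping.lookup a w"
proof -
  have "tscale c a = Poly_Mapping.map ((*) c) a"
    by (simp add: tscale_def mult_map_scale_conv_mult zero_list_def)
  then show ?thesis by (simp add: Poly_Mapping.map.rep_eq when_def)
qed

lemma tscale_word: "tscale c (word w) = Poly_Mapping.single w c"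
  by (simp add: tscale_def word_def mult_single plus_list_def)

lemma word_mult: "word u * word v = word (u @ v)"
  by (simp add: word_def mult_single plus_list_def)

lemma word_Nil: "word [] = 1"
  using single_one [where ?'a = "'a list"] by (simp add: word_def zero_list_def)

lemma tscale_mult_left: "tscale c a * b = tscale c (a * b)"
  by (simp add: tscale_def mult.assoc)

lemma tensor_expansion: "a = (\<Sum>w\<in>Poly_Mapping.keys a. tscale (Poly_Mapping.lookup a w) (word w))"
  by (rule poly_mapping_eqI) (auto simp: lookup_sum word_def lookup_single when_def in_keys_iff if_distrib cong: if_cong)

text \<open>Words span \<open>T(V)\<close>; most identities between linear maps below are reduced by
  this rule to the case of a single word.\<close>

lemma tensor_induct [case_names zero add]:
  assumes "P 0" "\<And>a c w. P a \<Longrightarrow> P (tscale c (word w) + a)"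
  shows "P a"
proof -
  have "P (\<Sum>w\<in>A. tscale (Poly_Mapping.lookup a w) (word w))" if "finite A" for A
    using that by induct (auto simp: assms)
  then show ?thesis
    using tensor_expansion [of a] by (metis finite_keys)
qed

text \<open>Since \<open>tscale\<close> is a multiplication from the left, this expresses that the
  scalars are central, which is checked on words.\<close>

lemma tscale_mult_right: "a * tscale c b = tscale c (a * b)"
proof -
  have "a * Poly_Mapping.single [] c = Poly_Mapping.single [] c * a"
    by (induct a rule: tensor_induct)
      (simp_all add: distrib_left distrib_right tscale_word mult_single plus_list_def mult.commute)
  then show ?thesis by (simp add: tscale_def mult.assoc flip: mult.assoc)
qed

lemma word_Cons: "word (i # w) = word [i] * word w"
  by (simp add: word_mult)

lemma tlinear_linear_ext:
  fixes f :: "'n list \<Rightarrow> ('n, 'a::field) tensor"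
  shows "tlinear (linear_ext f)"
proof (rule tlinearI)
  \<comment> \<open>Supports may shrink under addition and scaling, so all sums are first taken over
    a common finite set of words.\<close>
  have eq: "linear_ext f a = (\<Sum>w\<in>A. tscale (Poly_Mapping.lookup a w) (f w))"
    if "finite A" "Poly_Mapping.keys a \<subseteq> A" for a A
    unfolding linear_ext_def using that by (intro sum.mono_neutral_left) (auto simp: in_keys_iff)
  fix a b :: "('n, 'a) tensor" and c
  let ?A = "Poly_Mapping.keys a \<union> Poly_Mapping.keys b"
  have "Poly_Mapping.keys (a + b) \<subseteq> ?A"
    by (rule keys_add)
  then show "linear_ext f (a + b) = linear_ext f a + linear_ext f b"
    by (simp add: eq [where A = ?A] lookup_add tensor.scale_left_distrib sum.distrib)
  have "Poly_Mapping.keys (tscale c a) \<subseteq> ?A"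
    by (auto simp: in_keys_iff)
  then show "linear_ext f (tscale c a) = tscale c (linear_ext f a)"
    by (simp add: eq [where A = ?A] tensor.scale_sum_right)
qed

lemmas linear_ext_add [simp] = tensor_pair.linear_add [OF tlinear_linear_ext]
lemmas linear_ext_tscale [simp] = tensor_pair.linear_scale [OF tlinear_linear_ext]
lemmas linear_ext_0 [simp] = tensor_pair.linear_0 [OF tlinear_linear_ext]
lemmas linear_ext_diff [simp] = tensor_pair.linear_diff [OF tlinear_linear_ext]

lemma linear_ext_word [simp]: "linear_ext f (word w) = f w"
  by (simp add: linear_ext_def word_def)

lemma linear_ext_1 [simp]: "linear_ext f 1 = f []"
  by (simp flip: word_Nil)

section \<open>Quantum shuffles\<close>

text \<open>
  The quantum shuffle products of a letter with a word: the letter is inserted at all places, with a factor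
  \<open>q\<close> for every letter that it passes. The quantum symmetrizer is the algebra homomorphism from \<open>T(V)\<close> to the
  quantum shuffle algebra that fixes the letters; hence its kernel is an ideal.
\<close>

primrec shuffle_left_word :: "('n \<Rightarrow> 'n \<Rightarrow> 'a::field) \<Rightarrow> 'n \<Rightarrow> 'n list \<Rightarrow> ('n, 'a) tensor" where
  "shuffle_left_word q i [] = word [i]"
| "shuffle_left_word q i (y # v) = word (i # y # v) + tscale (q i y) (word [y] * shuffle_left_word q i v)"

definition shuffle_left :: "('n \<Rightarrow> 'n \<Rightarrow> 'a::field) \<Rightarrow> 'n \<Rightarrow> ('n, 'a) tensor \<Rightarrow> ('n, 'a) tensor" where
  "shuffle_left q i = linear_ext (shuffle_left_word q i)"

text \<open>The factor that \<open>j\<close> collects on its way from the right end of a word to its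
  front.\<close>

definition pass_letter :: "('n \<Rightarrow> 'n \<Rightarrow> 'a::field) \<Rightarrow> 'n \<Rightarrow> ('n, 'a) tensor \<Rightarrow> ('n, 'a) tensor" where
  "pass_letter q j = linear_ext (\<lambda>v. tscale (\<Prod>u\<leftarrow>v. q u j) (word v))"

text \<open>The recursion runs from the front, as for \<open>shuffle_left_word\<close>, although
  \<open>j\<close> enters from the right. Either \<open>j\<close> ends up in front, having passed
  the whole word, or it stays behind \<open>y\<close>.\<close>

primrec shuffle_right_word :: "('n \<Rightarrow> 'n \<Rightarrow> 'a::field) \<Rightarrow> 'n \<Rightarrow> 'n list \<Rightarrow> ('n, 'a) tensor" where
  "shuffle_right_word q j [] = word [j]"
| "shuffle_right_word q j (y # v) =
     word [j] * pass_letter q j (word (y # v)) + word [y] * shuffle_right_word q j v"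

definition shuffle_right :: "('n \<Rightarrow> 'n \<Rightarrow> 'a::field) \<Rightarrow> 'n \<Rightarrow> ('n, 'a) tensor \<Rightarrow> ('n, 'a) tensor" where
  "shuffle_right q j = linear_ext (shuffle_right_word q j)"

text \<open>The quantum shuffle product of the letters of a word, evaluated from the right
  end.\<close>

primrec symmetrized_word :: "('n \<Rightarrow> 'n \<Rightarrow> 'a::field) \<Rightarrow> 'n list \<Rightarrow> ('n, 'a) tensor" where
  "symmetrized_word q [] = 1"
| "symmetrized_word q (i # w) = shuffle_left q i (symmetrized_word q w)"

definition symmetrize :: "('n \<Rightarrow> 'n \<Rightarrow> 'a::field) \<Rightarrow> ('n, 'a) tensor \<Rightarrow> ('n, 'a) tensor" where
  "symmetrize q = linear_ext (symmetrized_word q)"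

lemma shuffle_left_linear [simp]:
  "shuffle_left q i (a + b) = shuffle_left q i a + shuffle_left q i b"
  "shuffle_left q i (a - b) = shuffle_left q i a - shuffle_left q i b"
  "shuffle_left q i (tscale c a) = tscale c (shuffle_left q i a)"
  "shuffle_left q i 0 = 0"
  by (simp_all add: shuffle_left_def)

lemma pass_letter_linear [simp]:
  "pass_letter q i (a + b) = pass_letter q i a + pass_letter q i b"
  "pass_letter q i (tscale c a) = tscale c (pass_letter q i a)"
  "pass_letter q i 0 = 0"
  by (simp_all add: pass_letter_def)

lemma shuffle_right_linear [simp]:
  "shuffle_right q i (a + b) = shuffle_right q i a + shuffle_right q i b"
  "shuffle_right q i (a - b) = shuffle_right q i a - shuffle_right q i b"
  "shuffle_right q i (tscale c a) = tscale c (shuffle_right q i a)"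
  "shuffle_right q i 0 = 0"
  by (simp_all add: shuffle_right_def)

lemma symmetrize_linear [simp]:
  "symmetrize q (a + b) = symmetrize q a + symmetrize q b"
  "symmetrize q (a - b) = symmetrize q a - symmetrize q b"
  "symmetrize q (tscale c a) = tscale c (symmetrize q a)"
  "symmetrize q 0 = 0"
  by (simp_all add: symmetrize_def)

lemma shuffle_left_word_eq: "shuffle_left q i (word w) = shuffle_left_word q i w"
  by (simp add: shuffle_left_def)

lemma shuffle_right_word_eq: "shuffle_right q i (word w) = shuffle_right_word q i w"
  by (simp add: shuffle_right_def)

lemma shuffle_left_1 [simp]: "shuffle_left q i 1 = word [i]"
  by (simp add: shuffle_left_def)

lemma shuffle_right_1 [simp]: "shuffle_right q i 1 = word [i]"
  by (simp add: shuffle_right_def)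

lemma symmetrize_1 [simp]: "symmetrize q 1 = 1"
  by (simp add: symmetrize_def)

lemma symmetrize_word: "symmetrize q (word w) = symmetrized_word q w"
  by (simp add: symmetrize_def)

lemmas tensor_simps = distrib_left distrib_right tscale_mult_left tscale_mult_right
  tensor.scale_right_distrib

section \<open>Insertion from the left commutes with insertion from the right\<close>

lemma shuffle_left_Cons:
  "shuffle_left q i (word [y] * a) =
     word [i] * (word [y] * a) + tscale (q i y) (word [y] * shuffle_left q i a)"
proof (induct a rule: tensor_induct)
  case (add a c w)
  have "shuffle_left q i (word [y] * word w) =
     word [i] * (word [y] * word w) + tscale (q i y) (word [y] * shuffle_left q i (word w))"
    by (simp add: shuffle_left_def word_mult)
  with add show ?case
    by (simp add: tensor_simps mult.commute)
qed simp

lemma pass_letter_Cons: "pass_letter q j (word [y] * a) = tscale (q y j) (word [y] * pass_letter q j a)"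
proof (induct a rule: tensor_induct)
  case (add a c w)
  have "pass_letter q j (word [y] * word w) = tscale (q y j) (word [y] * pass_letter q j (word w))"
    by (simp add: pass_letter_def word_mult tscale_mult_right)
  with add show ?case
    by (simp add: tensor_simps mult.commute)
qed simp

lemma shuffle_right_Cons:
  "shuffle_right q j (word [y] * a) =
     word [j] * pass_letter q j (word [y] * a) + word [y] * shuffle_right q j a"
proof (induct a rule: tensor_induct)
  case (add a c w)
  have "shuffle_right q j (word [y] * word w) =
     word [j] * pass_letter q j (word [y] * word w) + word [y] * shuffle_right q j (word w)"
    by (simp add: shuffle_right_def word_mult)
  with add show ?case
    by (simp add: tensor_simps)
qed simp

lemma pass_letter_1 [simp]: "pass_letter q j 1 = 1"
  by (simp add: pass_letter_def word_Nil)

text \<open>The factor of \<open>pass_letter\<close> depends only on the letters of a word with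
  multiplicities, and every term of the shuffle has exactly one more \<open>i\<close>.\<close>

lemma pass_letter_shuffle_left:
  "pass_letter q j (shuffle_left q i a) = tscale (q i j) (shuffle_left q i (pass_letter q j a))"
proof (induct a rule: tensor_induct)
  case (add a c w)
  have "pass_letter q j (shuffle_left q i (word w)) = tscale (q i j) (shuffle_left q i (pass_letter q j (word w)))"
  proof (induct w)
    case Nil
    show ?case using pass_letter_Cons [of q j i 1] by (simp add: word_Nil)
  next
    case (Cons y w)
    then show ?case
      by (simp add: word_Cons [of y w] shuffle_left_Cons pass_letter_Cons tensor_simps mult.commute mult.left_commute)
  qed
  with add show ?case
    by (simp add: tensor_simps mult.commute)
qed simp

text \<open>The instance of associativity of the quantum shuffle product with single letters on both
  sides. When \<open>j\<close> goes to the front, the factor \<open>q i j\<close> for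
  \<open>i\<close> passing \<open>j\<close> is matched by the one in
  \<open>pass_letter_shuffle_left\<close>.\<close>

lemma shuffle_left_right_commute:
  "shuffle_left q i (shuffle_right q j a) = shuffle_right q j (shuffle_left q i a)"
proof (induct a rule: tensor_induct)
  case (add a c w)
  have "shuffle_left q i (shuffle_right q j (word w)) = shuffle_right q j (shuffle_left q i (word w))"
  proof (induct w)
    case Nil
    show ?case 
      using shuffle_left_Cons [of q i j 1] shuffle_right_Cons [of q j i 1] pass_letter_Cons [of q j i 1]
      by (simp add: word_Nil tensor_simps)
  next
    case (Cons y w)
    then show ?case
      by (simp add: word_Cons [of y w] shuffle_left_Cons shuffle_right_Cons pass_letter_Cons
          pass_letter_shuffle_left tensor_simps ac_simps)
  qed
  with add show ?case
    by (simp add: tensor_simps)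
qed simp

lemma symmetrize_Cons: "symmetrize q (word [i] * a) = shuffle_left q i (symmetrize q a)"
proof (induct a rule: tensor_induct)
  case (add a c w)
  have "symmetrize q (word [i] * word w) = shuffle_left q i (symmetrize q (word w))"
    by (simp add: symmetrize_def word_mult)
  with add show ?case
    by (simp add: tensor_simps)
qed simp

text \<open>\<open>symmetrize\<close> is built by insertion from the left. As both kinds of
  insertion commute, it can equally be built from the right, which is what makes its kernel closed
  under multiplication on the right.\<close>

lemma symmetrize_snoc: "symmetrize q (a * word [j]) = shuffle_right q j (symmetrize q a)"
proof (induct a rule: tensor_induct)
  case (add a c w)
  have "symmetrize q (word w * word [j]) = shuffle_right q j (symmetrize q (word w))"
  proof (induct w)
    case Nil
    show ?case using symmetrize_Cons [of q j 1] by (simp add: word_Nil)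
  next
    case (Cons y w)
    then show ?case
      by (simp add: word_Cons [of y w] symmetrize_Cons mult.assoc shuffle_left_right_commute)
  qed
  with add show ?case
    by (simp add: tensor_simps)
qed simp

section \<open>The kernel is a two-sided ideal\<close>

lemma symmetrize_eq_0_mult_left:
  assumes "symmetrize q a = 0"
  shows "symmetrize q (b * a) = 0"
proof (induct b rule: tensor_induct)
  case (add b c w)
  have "symmetrize q (word w * a) = 0"
  proof (induct w)
    case (Cons y w)
    then show ?case
      by (simp add: word_Cons [of y w] symmetrize_Cons mult.assoc)
  qed (simp add: assms word_Nil)
  with add show ?case
    by (simp add: tensor_simps)
qed simp

lemma symmetrize_eq_0_mult_right:
  assumes "symmetrize q a = 0"
  shows "symmetrize q (a * b) = 0"
proof (induct b rule: tensor_induct)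
  case (add b c w)
  have "symmetrize q (a * word w) = 0"
  proof (induct w rule: rev_induct)
    case (snoc y w)
    then show ?case
      by (simp add: symmetrize_snoc flip: word_mult mult.assoc)
  qed (simp add: assms word_Nil)
  with add show ?case
    by (simp add: tensor_simps)
qed simp

section \<open>Coefficients of symmetrized commutators\<close>

lemma lookup_word: "Poly_Mapping.lookup (word v) w = (if v = w then 1 else 0)"
  by (simp add: word_def lookup_single when_def)

lemma lookup_word_mult_Cons:
  "Poly_Mapping.lookup (word [y] * a) (z # w) = (if y = z then Poly_Mapping.lookup a w else 0)"
proof (induct a rule: tensor_induct)
  case (add a c v)
  then show ?case
    by (auto simp: tensor_simps lookup_add word_mult lookup_word)
qed simp

lemma lookup_word_mult_Nil: "Poly_Mapping.lookup (word [y] * a) [] = 0"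
proof (induct a rule: tensor_induct)
  case (add a c v)
  then show ?case
    by (auto simp: tensor_simps lookup_add word_mult lookup_word)
qed simp

lemmas lookup_simps = lookup_add lookup_minus lookup_word lookup_word_mult_Cons lookup_word_mult_Nil

lemma lookup_shuffle_left_word_notin:
  "i \<notin> set w \<Longrightarrow> Poly_Mapping.lookup (shuffle_left_word q i v) w = 0"
proof (induct v arbitrary: w)
  case (Cons y v)
  then show ?case by (cases w) (auto simp: lookup_simps)
qed (auto simp: lookup_simps)

lemma lookup_shuffle_right_word_notin:
  "i \<notin> set w \<Longrightarrow> Poly_Mapping.lookup (shuffle_right_word q i v) w = 0"
proof (induct v arbitrary: w)
  case (Cons y v)
  then show ?case by (cases w) (auto simp: lookup_simps)
qed (auto simp: lookup_simps)

context
  fixes i j :: 'n and q :: "'n \<Rightarrow> 'n \<Rightarrow> 'a::field"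
  assumes neq: "i \<noteq> j"
begin

text \<open>Only a power of \<open>i\<close> can give a power of \<open>i\<close>, and the
  \<open>k + 1\<close> places for the new letter contribute the successive powers of
  \<open>q i i\<close>.\<close>

lemma lookup_shuffle_left_replicate:
  "Poly_Mapping.lookup (shuffle_left_word q i v) (replicate (Suc k) i) =
     (if v = replicate k i then \<Sum>l\<le>k. q i i ^ l else 0)"
proof (induct k arbitrary: v)
  case 0
  show ?case by (cases v) (auto simp: lookup_simps lookup_shuffle_left_word_notin)
next
  case (Suc k)
  show ?case
    using Suc [of "tl v"] 
    by (cases v) (auto simp: lookup_simps sum.atMost_Suc_shift sum_distrib_left simp del: sum.atMost_Suc)
qed

lemma lookup_shuffle_right_replicate:
  "Poly_Mapping.lookup (shuffle_right_word q i v) (replicate (Suc k) i) =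
     (if v = replicate k i then \<Sum>l\<le>k. q i i ^ l else 0)"
proof (induct k arbitrary: v)
  case 0
  show ?case by (cases v) (auto simp: lookup_simps lookup_shuffle_right_word_notin pass_letter_def)
next
  case (Suc k)
  show ?case
    using Suc [of "tl v"] 
    by (cases v) (auto simp: lookup_simps pass_letter_def)
qed

text \<open>Here and in the next three lemmas, the target word tells on which side of
  \<open>j\<close> the new \<open>i\<close> must end up. If it has to pass \<open>j\<close>, this
  costs \<open>q i j\<close> from the left and \<open>q j i\<close> from the right; the places among
  the other \<open>i\<close> give the quantum integer.\<close>

lemma lookup_shuffle_left_snoc:
  "Poly_Mapping.lookup (shuffle_left q i a) (replicate (Suc k) i @ [j]) =
     (\<Sum>l\<le>k. q i i ^ l) * Poly_Mapping.lookup a (replicate k i @ [j])"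
proof (induct a rule: tensor_induct)
  case (add a c v)
  have "Poly_Mapping.lookup (shuffle_left_word q i v) (replicate (Suc k) i @ [j]) =
     (if v = replicate k i @ [j] then \<Sum>l\<le>k. q i i ^ l else 0)"
  proof (induct k arbitrary: v)
    case 0
    show ?case using neq by (cases v) (auto simp: lookup_simps lookup_shuffle_left_word_notin)
  next
    case (Suc k)
    show ?case
      using Suc [of "tl v"] neq
      by (cases v) (auto simp: lookup_simps sum.atMost_Suc_shift sum_distrib_left simp del: sum.atMost_Suc)
  qed
  with add show ?case
    by (auto simp: lookup_simps shuffle_left_word_eq algebra_simps simp del: replicate_Suc)
qed simp

lemma lookup_shuffle_left_Cons:
  "Poly_Mapping.lookup (shuffle_left q i a) (j # replicate (Suc k) i) =
     q i j * (\<Sum>l\<le>k. q i i ^ l) * Poly_Mapping.lookup a (j # replicate k i)"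
proof (induct a rule: tensor_induct)
  case (add a c v)
  have "Poly_Mapping.lookup (shuffle_left_word q i v) (j # replicate (Suc k) i) =
     (if v = j # replicate k i then q i j * (\<Sum>l\<le>k. q i i ^ l) else 0)"
    using neq by (cases v) (auto simp: lookup_simps lookup_shuffle_left_replicate simp del: replicate_Suc)
  with add show ?case
    by (auto simp: lookup_simps shuffle_left_word_eq algebra_simps simp del: replicate_Suc)
qed simp

lemma lookup_shuffle_right_snoc:
  "Poly_Mapping.lookup (shuffle_right q i a) (replicate (Suc k) i @ [j]) =
     q j i * (\<Sum>l\<le>k. q i i ^ l) * Poly_Mapping.lookup a (replicate k i @ [j])"
proof (induct a rule: tensor_induct)
  case (add a c v)
  have "Poly_Mapping.lookup (shuffle_right_word q i v) (replicate (Suc k) i @ [j]) =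
     (if v = replicate k i @ [j] then q j i * (\<Sum>l\<le>k. q i i ^ l) else 0)"
  proof (induct k arbitrary: v)
    case 0
    show ?case using neq by (cases v) (auto simp: lookup_simps lookup_shuffle_right_word_notin pass_letter_def)
  next
    case (Suc k)
    show ?case
      using Suc [of "tl v"] neq
      by (cases v) (auto simp: lookup_simps pass_letter_def algebra_simps)
  qed
  with add show ?case
    by (auto simp: lookup_simps shuffle_right_word_eq algebra_simps simp del: replicate_Suc)
qed simp

lemma lookup_shuffle_right_Cons:
  "Poly_Mapping.lookup (shuffle_right q i a) (j # replicate (Suc k) i) =
     (\<Sum>l\<le>k. q i i ^ l) * Poly_Mapping.lookup a (j # replicate k i)"
proof (induct a rule: tensor_induct)
  case (add a c v)
  have "Poly_Mapping.lookup (shuffle_right_word q i v) (j # replicate (Suc k) i) =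
     (if v = j # replicate k i then \<Sum>l\<le>k. q i i ^ l else 0)"
    using neq by (cases v) (auto simp: lookup_simps lookup_shuffle_right_replicate simp del: replicate_Suc)
  with add show ?case
    by (auto simp: lookup_simps shuffle_right_word_eq algebra_simps simp del: replicate_Suc)
qed simp

text \<open>Each commutator is a left insertion minus a right one. At the word ending in
  \<open>j\<close> only the right one passes \<open>j\<close>, which gives \<open>1 - q j i\<close>;
  at the word beginning with \<open>j\<close> only the left one does, which gives
  \<open>q i j - 1\<close>.\<close>

lemma lookup_symmetrize_ad_power:
  defines "b k \<equiv> ((\<lambda>a. word [i] * a - a * word [i]) ^^ k) (word [j])"
  shows "Poly_Mapping.lookup (symmetrize q (b k)) (replicate k i @ [j]) =
           (1 - q j i) ^ k * (\<Prod>m<k. \<Sum>l\<le>m. q i i ^ l)" (is "?snoc k")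
    and "Poly_Mapping.lookup (symmetrize q (b k)) (j # replicate k i) =
           (q i j - 1) ^ k * (\<Prod>m<k. \<Sum>l\<le>m. q i i ^ l)" (is "?Cons k")
proof -
  have b_Suc: "b (Suc k) = word [i] * b k - b k * word [i]" for k
    by (simp add: b_def)
  have b_0: "symmetrize q (b 0) = word [j]"
    by (simp add: b_def symmetrize_word)
  show "?snoc k"
  proof (induct k)
    case (Suc k)
    show ?case
      unfolding b_Suc symmetrize_linear symmetrize_Cons symmetrize_snoc lookup_minus
        lookup_shuffle_left_snoc lookup_shuffle_right_snoc Suc
      by (simp add: algebra_simps)
  qed (simp add: b_0 lookup_simps)
  show "?Cons k"
  proof (induct k)
    case (Suc k)
    show ?case
      unfolding b_Suc symmetrize_linear symmetrize_Cons symmetrize_snoc lookup_minus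
        lookup_shuffle_left_Cons lookup_shuffle_right_Cons Suc
      by (simp add: algebra_simps)
  qed (simp add: b_0 lookup_simps)
qed

end

lemma shuffle_left_word_replicate:
  "shuffle_left_word q i (replicate k i) = tscale (\<Sum>l\<le>k. q i i ^ l) (word (replicate (Suc k) i))"
proof (induct k)
  case (Suc k)
  then show ?case
    by (simp add: sum.atMost_Suc_shift sum_distrib_left tscale_mult_right word_mult tensor.scale_left_distrib
        del: sum.atMost_Suc)
qed simp

text \<open>The scalar is the quantum factorial of \<open>k\<close> at \<open>q i i\<close>, the
  same product as in \<open>lookup_symmetrize_ad_power\<close>.\<close>

lemma symmetrize_replicate:
  "symmetrize q (word (replicate k i)) =
     tscale (\<Prod>m<k. \<Sum>l\<le>m. q i i ^ l) (word (replicate k i))"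
proof (induct k)
  case (Suc k)
  then show ?case
    by (simp add: symmetrize_word shuffle_left_word_eq shuffle_left_word_replicate mult.commute)
qed (simp add: symmetrize_word word_Nil)

text \<open>Not both \<open>q i j\<close> and \<open>q j i\<close> are 1, so one of the two
  coefficients forces the quantum factorial to vanish.\<close>

lemma symmetrize_replicate_eq_0:
  assumes "i \<noteq> j" "q i j * q j i \<noteq> 1"
    and "symmetrize q (((\<lambda>a. word [i] * a - a * word [i]) ^^ k) (word [j])) = 0"
  shows "symmetrize q (word (replicate k i)) = 0"
proof -
  have "(1 - q j i) ^ k * (\<Prod>m<k. \<Sum>l\<le>m. q i i ^ l) = 0"
    "(q i j - 1) ^ k * (\<Prod>m<k. \<Sum>l\<le>m. q i i ^ l) = 0"
    using lookup_symmetrize_ad_power [OF assms(1), where q = q and k = k] assms(3) by simp_all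
  moreover have "1 - q j i \<noteq> 0 \<or> q i j - 1 \<noteq> 0"
    using assms(2) by auto
  ultimately have "(\<Prod>m<k. \<Sum>l\<le>m. q i i ^ l) = 0"
    by (metis mult_eq_0_iff power_not_zero)
  then show ?thesis
    by (simp only: symmetrize_replicate) simp
qed

section \<open>Nilpotency from nilpotent generators\<close>

text \<open>Ideals of a type class ring, in order to calculate in \<open>T(V)\<close> modulo an
  ideal instead of passing to quotient rings.\<close>

definition two_sided_ideal :: "'r::ring_1 set \<Rightarrow> bool" where
  "two_sided_ideal J \<longleftrightarrow> 0 \<in> J \<and> (\<forall>a\<in>J. \<forall>b\<in>J. a + b \<in> J) \<and> (\<forall>a\<in>J. \<forall>c. c * a \<in> J \<and> a * c \<in> J)"

lemma two_sided_idealD: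
  assumes "two_sided_ideal J"
  shows "0 \<in> J" "a \<in> J \<Longrightarrow> b \<in> J \<Longrightarrow> a + b \<in> J" "a \<in> J \<Longrightarrow> c * a \<in> J" "a \<in> J \<Longrightarrow> a * c \<in> J"
    "a \<in> J \<Longrightarrow> - a \<in> J" "a \<in> J \<Longrightarrow> b \<in> J \<Longrightarrow> a - b \<in> J"
proof -
  show 1: "0 \<in> J" "a \<in> J \<Longrightarrow> b \<in> J \<Longrightarrow> a + b \<in> J" "a \<in> J \<Longrightarrow> c * a \<in> J" "a \<in> J \<Longrightarrow> a * c \<in> J" for a b c
    using assms by (auto simp: two_sided_ideal_def)
  show 2: "a \<in> J \<Longrightarrow> - a \<in> J" for a
    using 1(3) [of a "-1"] by simp
  show "a \<in> J \<Longrightarrow> b \<in> J \<Longrightarrow> a - b \<in> J"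
    using 1(2) [of a "- b"] 2 by simp
qed

definition central_mod :: "'r::ring_1 set \<Rightarrow> 'r \<Rightarrow> bool" where
  "central_mod J z \<longleftrightarrow> (\<forall>a. z * a - a * z \<in> J)"

lemma central_mod_power:
  assumes J: "two_sided_ideal J" and z: "central_mod J z"
  shows "central_mod J (z ^ k)"
proof (induct k)
  case (Suc k)
  have "z ^ Suc k * a - a * z ^ Suc k = z * (z ^ k * a - a * z ^ k) + (z * a - a * z) * z ^ k" for a
    by (simp add: algebra_simps)
  with Suc z show ?case
    unfolding central_mod_def by (metis two_sided_idealD [OF J])
qed (simp add: central_mod_def two_sided_idealD [OF J])

text \<open>The Leibniz rule for the commutator with \<open>y\<close>, which takes \<open>x\<close>
  to \<open>z\<close>; centrality of \<open>z\<close> modulo \<open>J\<close> lets the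
  \<open>l + 1\<close> terms be collected.\<close>

lemma commutator_power:
  fixes x y :: "'r::ring_1"
  assumes J: "two_sided_ideal J" and z: "central_mod J z" and z_eq: "z = x * y - y * x"
  shows "x ^ Suc l * y - y * x ^ Suc l - of_nat (Suc l) * (z * x ^ l) \<in> J"
proof (induct l)
  case (Suc l)
  let ?e = "x ^ Suc l * y - y * x ^ Suc l - of_nat (Suc l) * (z * x ^ l)"
  have "x * (of_nat (Suc l) * (z * x ^ l)) = of_nat (Suc l) * (x * (z * x ^ l))"
    by (metis mult.assoc mult_of_nat_commute)
  then have "x ^ Suc (Suc l) * y - y * x ^ Suc (Suc l) - of_nat (Suc (Suc l)) * (z * x ^ Suc l) =
    x * ?e - of_nat (Suc l) * ((z * x - x * z) * x ^ l)"
    by (simp add: z_eq algebra_simps)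
  then show ?case
    using Suc z unfolding central_mod_def by (metis two_sided_idealD [OF J])
qed (simp add: z_eq two_sided_idealD [OF J])

text \<open>The derivation \<open>a \<mapsto> a y - y a\<close> maps \<open>z\<^sup>k x\<^sup>l\<^sup>+\<^sup>1\<close> to \<open>(l + 1) z\<^sup>k\<^sup>+\<^sup>1 x\<^sup>l\<close> modulo \<open>J\<close>.\<close>

lemma commutator_nilpotent:
  fixes x y :: "'r::ring_1"
  assumes J: "two_sided_ideal J" and z: "central_mod J z" and z_eq: "z = x * y - y * x"
    and char: "\<And>n. 0 < n \<Longrightarrow> \<exists>d. d * of_nat n = (1 :: 'r)"
    and x: "x ^ m \<in> J"
  shows "z ^ m \<in> J"
proof -
  \<comment> \<open>The factors \<open>x\<close> are exchanged for \<open>z\<close> one at a time: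
    \<open>k = 0\<close> is the assumption on \<open>x\<close>, and \<open>l = 0\<close> is the
    claim.\<close>
  have "k + l = m \<Longrightarrow> z ^ k * x ^ l \<in> J" for k l
  proof (induct k arbitrary: l)
    case 0
    then show ?case using x by simp
  next
    case (Suc k)
    let ?c = "z ^ k * x ^ Suc l"
    let ?n = "of_nat (Suc l) :: 'r"
    have "?c \<in> J" using Suc.hyps [of "Suc l"] Suc.prems by (simp del: power_Suc)
    then have 1: "?c * y - y * ?c \<in> J"
      by (simp add: two_sided_idealD [OF J])
    have 2: "z ^ k * (x ^ Suc l * y - y * x ^ Suc l - ?n * (z * x ^ l)) \<in> J"
      by (intro two_sided_idealD [OF J] commutator_power [OF J z z_eq])
    have 3: "(z ^ k * y - y * z ^ k) * x ^ Suc l \<in> J"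
      using central_mod_power [OF J z] by (simp add: central_mod_def two_sided_idealD [OF J])
    have "?n * (z ^ Suc k * x ^ l) = z ^ k * (?n * (z * x ^ l))"
      by (simp only: power_Suc2 [of z] mult_of_nat_commute [of "Suc l" "z ^ k"] flip: mult.assoc)
    also have "\<dots> = (?c * y - y * ?c) - z ^ k * (x ^ Suc l * y - y * x ^ Suc l - ?n * (z * x ^ l))
        - (z ^ k * y - y * z ^ k) * x ^ Suc l"
      by (simp add: right_diff_distrib left_diff_distrib mult.assoc)
    also have "\<dots> \<in> J"
      by (intro two_sided_idealD(6) [OF J] 1 2 3)
    finally have 4: "?n * (z ^ Suc k * x ^ l) \<in> J" .
    \<comment> \<open>Division by \<open>l + 1\<close> is possible in characteristic zero.\<close>
    obtain d where "d * ?n = 1"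
      using char [of "Suc l"] by auto
    then have "z ^ Suc k * x ^ l = d * (?n * (z ^ Suc k * x ^ l))"
      by (metis mult.assoc mult_1)
    with 4 show ?case
      by (metis two_sided_idealD(3) [OF J])
  qed
  from this [of m 0] show ?thesis by simp
qed

section \<open>Enlarging an ideal by a central nilpotent element\<close>

definition nilpotent_mod :: "'r::ring_1 set \<Rightarrow> 'r set \<Rightarrow> bool" where
  "nilpotent_mod I J \<longleftrightarrow> (\<exists>s. \<forall>ys. length ys = s \<longrightarrow> set ys \<subseteq> J \<longrightarrow> prod_list ys \<in> I)"

text \<open>For \<open>z\<close> central modulo an ideal \<open>J\<close>, this is the ideal
  generated by \<open>J\<close> and \<open>z\<close>; multiples of \<open>z\<close> on one side
  suffice.\<close>

definition adjoin_central :: "'r::ring_1 \<Rightarrow> 'r set \<Rightarrow> 'r set" where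
  "adjoin_central z J = {a. \<exists>b. a - z * b \<in> J}"

lemma two_sided_ideal_adjoin_central:
  assumes J: "two_sided_ideal J" and z: "central_mod J z"
  shows "two_sided_ideal (adjoin_central z J)"
  unfolding two_sided_ideal_def
proof (intro conjI ballI allI)
  show "0 \<in> adjoin_central z J"
    unfolding adjoin_central_def using two_sided_idealD [OF J] by (auto intro: exI [of _ 0])
next
  fix a b assume "a \<in> adjoin_central z J" "b \<in> adjoin_central z J"
  then obtain c d where "a - z * c \<in> J" "b - z * d \<in> J"
    by (auto simp: adjoin_central_def)
  then have "(a - z * c) + (b - z * d) \<in> J"
    by (rule two_sided_idealD [OF J])
  then have "(a + b) - z * (c + d) \<in> J"
    by (simp add: algebra_simps)
  then show "a + b \<in> adjoin_central z J"
    by (auto simp: adjoin_central_def)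
next
  fix a c assume "a \<in> adjoin_central z J"
  then obtain b where b: "a - z * b \<in> J"
    by (auto simp: adjoin_central_def)
  have "(z * c - c * z) * b \<in> J"
    using z by (simp add: central_mod_def two_sided_idealD(4) [OF J])
  with two_sided_idealD(3) [OF J b] have "c * (a - z * b) - (z * c - c * z) * b \<in> J"
    by (rule two_sided_idealD(6) [OF J])
  then have "c * a - z * (c * b) \<in> J"
    by (simp add: algebra_simps)
  then show "c * a \<in> adjoin_central z J"
    by (auto simp: adjoin_central_def)
  have "(a - z * b) * c \<in> J"
    by (rule two_sided_idealD(4) [OF J b])
  then have "a * c - z * (b * c) \<in> J"
    by (simp add: algebra_simps)
  then show "a * c \<in> adjoin_central z J"
    by (auto simp: adjoin_central_def)
qed

lemma adjoin_central_superset: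
  assumes J: "two_sided_ideal J"
  shows "J \<subseteq> adjoin_central z J" "z \<in> adjoin_central z J"
proof -
  have "a - z * 0 \<in> J" if "a \<in> J" for a
    using that by simp
  then show "J \<subseteq> adjoin_central z J"
    by (auto simp: adjoin_central_def simp del: mult_zero_right)
  have "z - z * 1 \<in> J"
    using two_sided_idealD [OF J] by simp
  then show "z \<in> adjoin_central z J"
    by (auto simp: adjoin_central_def simp del: mult_1_right)
qed

text \<open>Modulo \<open>J\<close> every factor is a multiple of \<open>z\<close>, and all these
  \<open>z\<close> can be moved to the front.\<close>

lemma prod_list_adjoin_central:
  assumes J: "two_sided_ideal J" and z: "central_mod J z"
    and "set ys \<subseteq> adjoin_central z J"
  shows "\<exists>t. prod_list ys - z ^ length ys * t \<in> J"
  using assms(3)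
proof (induct ys)
  case Nil
  have "1 - 1 * 1 \<in> J"
    using two_sided_idealD [OF J] by simp
  then show ?case by (auto simp del: mult_1 mult_1_right)
next
  case (Cons y ys)
  then obtain t where t: "prod_list ys - z ^ length ys * t \<in> J"
    by auto
  from Cons obtain b where b: "y - z * b \<in> J"
    by (auto simp: adjoin_central_def)
  let ?k = "length ys"
  have "z ^ ?k * b - b * z ^ ?k \<in> J"
    using central_mod_power [OF J z] by (simp add: central_mod_def)
  then have "z * (z ^ ?k * b - b * z ^ ?k) * t \<in> J"
    by (rule two_sided_idealD(4) [OF J two_sided_idealD(3) [OF J]])
  then have "(y - z * b) * prod_list ys + z * b * (prod_list ys - z ^ ?k * t) - z * (z ^ ?k * b - b * z ^ ?k) * t \<in> J"
    by (intro two_sided_idealD(2,6) [OF J] two_sided_idealD(4) [OF J b] two_sided_idealD(3) [OF J t])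
  then have "prod_list (y # ys) - z ^ length (y # ys) * (b * t) \<in> J"
    by (simp add: algebra_simps)
  then show ?case ..
qed

text \<open>A product of \<open>m\<close> factors is a multiple of \<open>z ^ m\<close> modulo
  \<open>J\<close>, hence lies in \<open>J\<close>. A product of \<open>s * m\<close> factors is
  therefore cut into \<open>s\<close> blocks, each of which lies in \<open>J\<close>.\<close>

lemma nilpotent_mod_adjoin_central:
  assumes J: "two_sided_ideal J" and z: "central_mod J z" and zm: "z ^ m \<in> J"
    and "nilpotent_mod I J"
  shows "nilpotent_mod I (adjoin_central z J)"
proof -
  have block: "prod_list ys \<in> J" if ys: "set ys \<subseteq> adjoin_central z J" "length ys = m" for ys
  proof -
    obtain t where "prod_list ys - z ^ m * t \<in> J"
      using prod_list_adjoin_central [OF J z ys(1)] ys(2) by auto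
    then have "(prod_list ys - z ^ m * t) + z ^ m * t \<in> J"
      using zm by (intro two_sided_idealD(2) [OF J] two_sided_idealD(4) [OF J])
    then show ?thesis by simp
  qed
  have split: "\<exists>zs. length zs = s \<and> set zs \<subseteq> J \<and> prod_list zs = prod_list ys"
    if "set ys \<subseteq> adjoin_central z J" "length ys = s * m" for s ys
    using that
  proof (induct s arbitrary: ys)
    case (Suc s)
    have "set (drop m ys) \<subseteq> adjoin_central z J" "set (take m ys) \<subseteq> adjoin_central z J"
      using Suc.prems(1) by (meson order_trans set_drop_subset set_take_subset)+
    moreover from this obtain zs where "length zs = s" "set zs \<subseteq> J" "prod_list zs = prod_list (drop m ys)"
      using Suc(1) [of "drop m ys"] Suc.prems(2) by auto
    moreover have "prod_list ys = prod_list (take m ys) * prod_list (drop m ys)"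
      by (simp flip: prod_list.append)
    ultimately show ?case
      using block [of "take m ys"] Suc.prems(2)
      by (intro exI [of _ "prod_list (take m ys) # zs"]) auto
  qed auto
  from assms(4) obtain s where "\<And>ys. length ys = s \<Longrightarrow> set ys \<subseteq> J \<Longrightarrow> prod_list ys \<in> I"
    by (auto simp: nilpotent_mod_def)
  then have "\<forall>ys. length ys = s * m \<longrightarrow> set ys \<subseteq> adjoin_central z J \<longrightarrow> prod_list ys \<in> I"
    using split by metis
  then show ?thesis
    by (auto simp: nilpotent_mod_def)
qed

text \<open>The index counts the brackets, so the elements of \<open>left_normed d\<close> have
  degree \<open>d + 1\<close>.\<close>

primrec left_normed :: "nat \<Rightarrow> ('n, 'a::field) tensor set" where
  "left_normed 0 = range (\<lambda>i. word [i])"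
| "left_normed (Suc d) = (\<lambda>(i, a). word [i] * a - a * word [i]) ` (UNIV \<times> left_normed d)"

lemma finite_left_normed: "finite (left_normed d :: ('n::finite, 'a::field) tensor set)"
  by (induct d) auto

text \<open>The commutator with \<open>z\<close> is a derivation, so it suffices to test it on the
  generators.\<close>

lemma central_mod_tensorI:
  fixes J :: "('n, 'a::field) tensor set"
  assumes J: "two_sided_ideal J" and z: "\<And>i. word [i] * z - z * word [i] \<in> J"
  shows "central_mod J z"
proof -
  have w: "word w * z - z * word w \<in> J" for w
  proof (induct w)
    case (Cons i w)
    have "word [i] * (word w * z - z * word w) + (word [i] * z - z * word [i]) * word w \<in> J"
      by (intro two_sided_idealD [OF J] Cons z)
    then show ?case
      by (simp add: word_Cons [of i w] algebra_simps)
  qed (simp add: word_Nil two_sided_idealD [OF J])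
  have "a * z - z * a \<in> J" for a
  proof (induct a rule: tensor_induct)
    case (add a c w)
    have "tscale c 1 * (word w * z - z * word w) + (a * z - z * a) \<in> J"
      by (intro two_sided_idealD [OF J] add w)
    then show ?case
      by (simp add: algebra_simps tscale_mult_left tscale_mult_right tensor.scale_right_diff_distrib)
  qed (simp add: two_sided_idealD [OF J])
  then have "- (a * z - z * a) \<in> J" for a
    by (rule two_sided_idealD(5) [OF J])
  then show ?thesis
    by (simp add: central_mod_def)
qed

lemma of_nat_invertible_tensor:
  assumes "0 < n"
  shows "\<exists>d. d * of_nat n = (1 :: ('n, 'a::field_char_0) tensor)"
proof -
  have "(of_nat n :: ('n, 'a) tensor) = tscale (of_nat n) 1"
    by (simp add: tscale_def zero_list_def [symmetric])
  then have "tscale (inverse (of_nat n)) 1 * of_nat n = (1 :: ('n, 'a) tensor)"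
    using assms by (simp add: tscale_mult_left)
  then show ?thesis ..
qed

text \<open>Starting from \<open>I\<close>, ideals that are nilpotent modulo \<open>I\<close> are
  enlarged by commutators of smaller and smaller depth. At depth 0 all letters have been included,
  so a word is a product of elements of an ideal that is nilpotent modulo \<open>I\<close>.\<close>

theorem words_in_ideal:
  fixes I :: "('n::finite, 'a::field_char_0) tensor set"
  assumes I: "two_sided_ideal I"
    and nilpotent: "\<And>i. \<exists>m. word [i] ^ m \<in> I"
    and left_normed: "\<And>d. N \<le> d \<Longrightarrow> left_normed d \<subseteq> I"
  shows "\<exists>s. \<forall>w. length w = s \<longrightarrow> word w \<in> I"
proof -
  let ?good = "\<lambda>J. two_sided_ideal J \<and> I \<subseteq> J \<and> nilpotent_mod I J"
  have "\<exists>J. ?good J \<and> (\<forall>d\<ge>N - k. left_normed d \<subseteq> J)" if "k \<le> N" for k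
    using that
  proof (induct k)
    case 0
    have "nilpotent_mod I I"
      unfolding nilpotent_mod_def by (rule exI [of _ 1]) (auto simp: length_Suc_conv)
    then show ?case
      using I left_normed by auto
  next
    case (Suc k)
    define e where "e = N - Suc k"
    have e: "N - k = Suc e"
      using Suc.prems by (auto simp: e_def)
    obtain J where J: "?good J" "\<forall>d\<ge>Suc e. left_normed d \<subseteq> J"
      using Suc by (auto simp: e)
    \<comment> \<open>There are finitely many commutators of depth \<open>e\<close>, and they are
      adjoined one at a time.\<close>
    have "\<exists>J'. ?good J' \<and> J \<subseteq> J' \<and> F \<subseteq> J'" if "finite F" "F \<subseteq> left_normed e" for F
      using that
    proof (induct F)
      case empty
      then show ?case using J by blast
    next
      case (insert z F)
      then obtain J' where J': "?good J'" "J \<subseteq> J'" "F \<subseteq> J'"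
        by auto
      have "(word [i] * z - z * word [i]) \<in> left_normed (Suc e)" for i
        using insert.prems by auto
      \<comment> \<open>The commutators of \<open>z\<close> with letters have depth
        \<open>Suc e\<close> and lie in \<open>J\<close> already.\<close>
      then have z: "central_mod J' z"
        using J(2) J'(1,2) by (intro central_mod_tensorI) (blast, blast)
      \<comment> \<open>At depth 0, \<open>z\<close> is a letter and nilpotent by assumption;
        otherwise it is a commutator with a letter and inherits nilpotency from that letter.\<close>
      have "\<exists>m. z ^ m \<in> J'"
      proof (cases e)
        case 0
        then show ?thesis
          using insert.prems nilpotent J' by fastforce
      next
        case (Suc e')
        then obtain i y where zeq: "z = word [i] * y - y * word [i]"
          using insert.prems by auto
        obtain m where "word [i] ^ m \<in> I"
          using nilpotent by blast
        then have "word [i] ^ m \<in> J'"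
          using J'(1) by blast
        then have "z ^ m \<in> J'"
          using J'(1) by (intro commutator_nilpotent [OF _ z zeq] of_nat_invertible_tensor) auto
        then show ?thesis ..
      qed
      then obtain m where m: "z ^ m \<in> J'" ..
      have "?good (adjoin_central z J')"
        using J'(1) z m two_sided_ideal_adjoin_central nilpotent_mod_adjoin_central
          adjoin_central_superset(1) by blast
      moreover have "J' \<subseteq> adjoin_central z J'" "z \<in> adjoin_central z J'"
        using J'(1) by (auto intro: adjoin_central_superset(2) adjoin_central_superset(1) [THEN subsetD])
      ultimately show ?case
        using J' by (intro exI [of _ "adjoin_central z J'"]) blast
    qed
    from this [OF finite_left_normed order_refl]
    obtain J' where J': "?good J'" "J \<subseteq> J'" "left_normed e \<subseteq> J'"
      by blast
    have "left_normed d \<subseteq> J'" if "e \<le> d" for d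
      using that J(2) J' by (cases "d = e") (auto dest!: spec [of _ d])
    with J'(1) show ?case
      by (auto simp: e_def)
  qed
  from this [OF order_refl] obtain J where J: "?good J" "left_normed 0 \<subseteq> J"
    by (metis diff_self_eq_0 le_refl)
  then obtain s where s: "\<And>ys. length ys = s \<Longrightarrow> set ys \<subseteq> J \<Longrightarrow> prod_list ys \<in> I"
    by (auto simp: nilpotent_mod_def)
  have "(word w :: ('n, 'a) tensor) = prod_list (map (\<lambda>i. word [i]) w)" for w
  proof (induct w)
    case (Cons i w)
    then show ?case by (simp add: word_Cons [of i w])
  qed (simp add: word_Nil)
  moreover have "prod_list (map (\<lambda>i. word [i]) w :: ('n, 'a) tensor list) \<in> I" if "length w = s" for w :: "'n list"
    using J(2) that by (intro s) auto
  ultimately show ?thesis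
    by metis
qed

section \<open>Quantum symmetrizers as sums over inversions\<close>

text \<open>
  A permutation \<open>\<sigma>\<close> of \<open>{..<m}\<close> is represented by the list of the values of its inverse, so that
  multiplication by a simple transposition from the left swaps two adjacent entries. An expression is
  reduced if and only if every swap creates an inversion.
\<close>

definition swap_at :: "nat \<Rightarrow> 'b list \<Rightarrow> 'b list" where
  "swap_at k xs = xs[k := xs ! Suc k, Suc k := xs ! k]"

lemma length_swap_at [simp]: "length (swap_at k xs) = length xs"
  by (simp add: swap_at_def)

lemma mset_swap_at [simp]: "Suc k < length xs \<Longrightarrow> mset (swap_at k xs) = mset xs"
  unfolding swap_at_def by (subst list_update_swap) (simp_all add: mset_swap)

lemma set_swap_at [simp]: "Suc k < length xs \<Longrightarrow> set (swap_at k xs) = set xs"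
  by (metis mset_swap_at set_mset_mset)

lemma distinct_swap_at [simp]: "Suc k < length xs \<Longrightarrow> distinct (swap_at k xs) = distinct xs"
  unfolding swap_at_def by (subst distinct_swap) simp_all

lemma swap_at_swap_at: "Suc k < length xs \<Longrightarrow> swap_at k (swap_at k xs) = xs"
  by (rule nth_equalityI) (auto simp: swap_at_def nth_list_update)

lemma map_swap_at: "Suc k < length xs \<Longrightarrow> map f (swap_at k xs) = swap_at k (map f xs)"
  by (simp add: swap_at_def map_update)

lemma swap_at_Cons_Suc: "swap_at (Suc k) (x # xs) = x # swap_at k xs"
  by (simp add: swap_at_def)

text \<open>Smaller later entries are counted as a set, which gives the usual number of inversions
  for distinct lists.\<close>

primrec inversions :: "'b::linorder list \<Rightarrow> nat" where
  "inversions [] = 0"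
| "inversions (x # xs) = card {y \<in> set xs. y < x} + inversions xs"

text \<open>The entries are positions and \<open>f\<close> gives their letters. Each inversion of a
  distinct list contributes the braiding coefficient of the two letters that have crossed.\<close>

primrec inversion_coeff :: "('n \<Rightarrow> 'n \<Rightarrow> 'a::field) \<Rightarrow> ('b::linorder \<Rightarrow> 'n) \<Rightarrow> 'b list \<Rightarrow> 'a" where
  "inversion_coeff q f [] = 1"
| "inversion_coeff q f (x # xs) = (\<Prod>y\<in>{y \<in> set xs. y < x}. q (f y) (f x)) * inversion_coeff q f xs"

lemma sorted_inversions: "sorted xs \<Longrightarrow> inversions xs = 0"
proof (induct xs)
  case (Cons x xs)
  then have "{y \<in> set xs. y < x} = {}" by auto
  with Cons show ?case by (simp only: inversions.simps) simp
qed simp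

lemma sorted_inversion_coeff: "sorted xs \<Longrightarrow> inversion_coeff q f xs = 1"
proof (induct xs)
  case (Cons x xs)
  then have "{y \<in> set xs. y < x} = {}" by auto
  with Cons show ?case by (simp only: inversion_coeff.simps) simp
qed simp

text \<open>An adjacent swap changes the relative order of that one pair only.\<close>

lemma swap_at_ascent:
  assumes "distinct xs" "Suc k < length xs" "xs ! k < xs ! Suc k"
  shows "inversions (swap_at k xs) = Suc (inversions xs)"
    and "inversion_coeff q f (swap_at k xs) = q (f (xs ! k)) (f (xs ! Suc k)) * inversion_coeff q f xs"
proof -
  have "inversions (swap_at k xs) = Suc (inversions xs) \<and>
    inversion_coeff q f (swap_at k xs) = q (f (xs ! k)) (f (xs ! Suc k)) * inversion_coeff q f xs"
    using assms
  proof (induct k arbitrary: xs)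
    case 0
    then obtain a b v where xs: "xs = a # b # v"
      by (cases xs; cases "tl xs") auto
    with 0 have "a < b" "a \<notin> set v" by auto
    then have "{y \<in> set (a # v). y < b} = insert a {y \<in> set v. y < b}"
      "{y \<in> set (b # v). y < a} = {y \<in> set v. y < a}"
      by auto
    moreover have "a \<notin> {y \<in> set v. y < b}" "finite {y \<in> set v. y < b}"
      using \<open>a \<notin> set v\<close> by auto
    ultimately show ?case
      by (simp add: xs swap_at_def del: set_simps)
  next
    case (Suc k)
    then obtain x v where xs: "xs = x # v"
      by (cases xs) auto
    with Suc show ?case
      by (simp add: swap_at_Cons_Suc)
  qed
  then show "inversions (swap_at k xs) = Suc (inversions xs)"
    "inversion_coeff q f (swap_at k xs) = q (f (xs ! k)) (f (xs ! Suc k)) * inversion_coeff q f xs"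
    by auto
qed

lemma swap_at_descent:
  assumes "distinct xs" "Suc k < length xs" "xs ! Suc k < xs ! k"
  shows "inversions xs = Suc (inversions (swap_at k xs))"
  using swap_at_ascent(1) [of "swap_at k xs" k] assms
  by (simp add: swap_at_swap_at) (simp add: swap_at_def)

section \<open>Reduced expressions and inversions\<close>

abbreviation apply_swaps :: "nat list \<Rightarrow> 'b list \<Rightarrow> 'b list" where
  "apply_swaps ks xs \<equiv> foldr swap_at ks xs"

lemma apply_swaps_upt:
  assumes "\<forall>k\<in>set ks. Suc k < m"
  shows "length (apply_swaps ks [0..<m]) = m" "distinct (apply_swaps ks [0..<m])"
    "set (apply_swaps ks [0..<m]) = {..<m}" "inversions (apply_swaps ks [0..<m]) \<le> length ks"
proof -
  have "length (apply_swaps ks [0..<m]) = m \<and> distinct (apply_swaps ks [0..<m]) \<and>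
    set (apply_swaps ks [0..<m]) = {..<m} \<and> inversions (apply_swaps ks [0..<m]) \<le> length ks"
    using assms
  proof (induct ks)
    case Nil
    then show ?case by (auto simp: sorted_inversions)
  next
    case (Cons k ks)
    let ?xs = "apply_swaps ks [0..<m]"
    have xs: "length ?xs = m" "distinct ?xs" "set ?xs = {..<m}" "inversions ?xs \<le> length ks" "Suc k < m"
      using Cons by auto
    then have "?xs ! k \<noteq> ?xs ! Suc k"
      by (simp add: nth_eq_iff_index_eq)
    then have "inversions (swap_at k ?xs) \<le> Suc (length ks)"
      using swap_at_ascent(1) [of ?xs k] swap_at_descent [of ?xs k] xs
      by (cases "?xs ! k < ?xs ! Suc k") auto
    then show ?case using xs by simp
  qed
  then show "length (apply_swaps ks [0..<m]) = m" "distinct (apply_swaps ks [0..<m])"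
    "set (apply_swaps ks [0..<m]) = {..<m}" "inversions (apply_swaps ks [0..<m]) \<le> length ks"
    by auto
qed

lemma braiding_at_word:
  "Suc k < length w \<Longrightarrow> braiding_at q k (word w) = tscale (q (w ! k) (w ! Suc k)) (word (swap_at k w))"
  by (simp add: braiding_at_def swap_at_def)

lemma braiding_at_linear [simp]:
  "braiding_at q k (a + b) = braiding_at q k a + braiding_at q k b"
  "braiding_at q k (tscale c a) = tscale c (braiding_at q k a)"
  "braiding_at q k 0 = 0"
  by (simp_all add: braiding_at_def)

text \<open>Every swap creates an inversion, and the braiding supplies its factor. Writing the word
  as \<open>map f [0..<m]\<close> keeps repeated letters apart by their positions.\<close>

lemma apply_braidings_reduced:
  assumes "\<forall>k\<in>set ks. Suc k < m" "inversions (apply_swaps ks [0..<m]) = length ks"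
  shows "foldr (braiding_at q) ks (word (map f [0..<m])) =
    tscale (inversion_coeff q f (apply_swaps ks [0..<m])) (word (map f (apply_swaps ks [0..<m])))"
  using assms
proof (induct ks)
  case Nil
  then show ?case by (simp add: sorted_inversion_coeff)
next
  case (Cons k ks)
  let ?xs = "apply_swaps ks [0..<m]"
  have xs: "length ?xs = m" "distinct ?xs" "inversions ?xs \<le> length ks" "Suc k < m"
    using Cons.prems apply_swaps_upt [of ks m] by auto
  then have "?xs ! k \<noteq> ?xs ! Suc k"
    by (simp add: nth_eq_iff_index_eq)
  \<comment> \<open>At a descent, \<open>?xs\<close> would have more inversions than the
    \<open>length ks\<close> swaps that lead to it can create.\<close>
  then have less: "?xs ! k < ?xs ! Suc k"
    using swap_at_descent [of ?xs k] xs Cons.prems by (cases "?xs ! k < ?xs ! Suc k") auto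
  then have "inversions ?xs = length ks"
    using swap_at_ascent(1) [of ?xs k] xs Cons.prems by auto
  then have "foldr (braiding_at q) ks (word (map f [0..<m])) =
    tscale (inversion_coeff q f ?xs) (word (map f ?xs))"
    using Cons by simp
  then show ?case
    using xs swap_at_ascent(2) [OF xs(2) _ less, of q f]
    by (simp add: braiding_at_word map_swap_at mult.commute)
qed

text \<open>Bubble sort: an unsorted list has an adjacent descent, and undoing it removes exactly
  one inversion.\<close>

lemma ex_reduced_swaps:
  assumes "distinct xs" "set xs = {..<m}"
  shows "\<exists>ks. (\<forall>k\<in>set ks. Suc k < m) \<and> apply_swaps ks [0..<m] = xs \<and> length ks = inversions xs"
  using assms
proof (induct "inversions xs" arbitrary: xs)
  case 0
  have len: "length xs = m"
    using distinct_card [OF 0(2)] 0(3) by simp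
  have "\<not> xs ! Suc k < xs ! k" if "Suc k < length xs" for k
    using swap_at_descent [OF 0(2) that] 0(1) by linarith
  then have "sorted xs"
    unfolding sorted_iff_nth_Suc by (simp add: not_less)
  then have "xs = [0..<m]"
    using 0(2,3) by (intro sorted_distinct_set_unique) (simp_all add: atLeast0LessThan)
  then show ?case
    by (intro exI [of _ "[]"]) (simp add: sorted_inversions)
next
  case (Suc n)
  have len: "length xs = m"
    using distinct_card [OF Suc(3)] Suc(4) by simp
  have "\<not> sorted xs"
    using Suc(2) sorted_inversions [of xs] by linarith
  then obtain k where k: "Suc k < m" "xs ! Suc k < xs ! k"
    by (auto simp: sorted_iff_nth_Suc not_le len)
  then have n: "inversions xs = Suc (inversions (swap_at k xs))"
    using swap_at_descent [of xs k] Suc(3) len by simp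
  then obtain ks where "\<forall>k\<in>set ks. Suc k < m" "apply_swaps ks [0..<m] = swap_at k xs"
    "length ks = inversions (swap_at k xs)"
    using Suc(1) [of "swap_at k xs"] Suc(2-4) k len n by auto
  then show ?case
    using k len n
    by (intro exI [of _ "k # ks"]) (simp add: swap_at_swap_at)
qed

text \<open>Inversion turns composition with a transposition on the left into composition on the
  right, which exchanges two positions in the list of values.\<close>

lemma apply_swaps_eq_map_inv:
  fixes m :: nat
  assumes "\<forall>k\<in>set ks. Suc k < m"
  defines "\<sigma> \<equiv> foldr (\<lambda>k \<tau>. transpose k (Suc k) \<circ> \<tau>) ks id"
  shows "\<sigma> permutes {..<m}" "apply_swaps ks [0..<m] = map (Hilbert_Choice.inv \<sigma>) [0..<m]"
proof -
  have "\<sigma> permutes {..<m} \<and> apply_swaps ks [0..<m] = map (Hilbert_Choice.inv \<sigma>) [0..<m]"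
    using assms(1) unfolding \<sigma>_def
  proof (induct ks)
    case (Cons k ks)
    let ?\<tau> = "foldr (\<lambda>k \<tau>. transpose k (Suc k) \<circ> \<tau>) ks id"
    have "?\<tau> permutes {..<m} \<and> apply_swaps ks [0..<m] = map (Hilbert_Choice.inv ?\<tau>) [0..<m]"
      by (rule Cons.hyps) (use Cons.prems in simp)
    then have \<tau>: "?\<tau> permutes {..<m}" "apply_swaps ks [0..<m] = map (Hilbert_Choice.inv ?\<tau>) [0..<m]"
      by blast+
    have k: "Suc k < m"
      using Cons.prems by simp
    have t: "transpose k (Suc k) permutes {..<m}"
      using k by (intro permutes_swap_id) auto
    have "Hilbert_Choice.inv (transpose k (Suc k) \<circ> ?\<tau>) = Hilbert_Choice.inv ?\<tau> \<circ> transpose k (Suc k)"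
      using permutes_bij [OF \<tau>(1)] by (subst o_inv_distrib) auto
    moreover have "swap_at k (map (Hilbert_Choice.inv ?\<tau>) [0..<m]) = map (Hilbert_Choice.inv ?\<tau> \<circ> transpose k (Suc k)) [0..<m]"
      using k by (intro nth_equalityI) (auto simp: swap_at_def nth_list_update transpose_def)
    moreover have "transpose k (Suc k) \<circ> ?\<tau> permutes {..<m}"
      by (rule permutes_compose [OF \<tau>(1) t])
    moreover have "foldr (\<lambda>k \<tau>. transpose k (Suc k) \<circ> \<tau>) (k # ks) id = transpose k (Suc k) \<circ> ?\<tau>"
      "apply_swaps (k # ks) [0..<m] = swap_at k (apply_swaps ks [0..<m])"
      by simp_all
    ultimately show ?case
      unfolding \<tau>(2) by (simp only: simp_thms)
  qed (simp add: permutes_id)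
  then show "\<sigma> permutes {..<m}" "apply_swaps ks [0..<m] = map (Hilbert_Choice.inv \<sigma>) [0..<m]"
    by auto
qed

lemma permutes_eqI_map_inv:
  fixes m :: nat
  assumes "\<sigma> permutes {..<m}" "\<tau> permutes {..<m}" "map (Hilbert_Choice.inv \<sigma>) [0..<m] = map (Hilbert_Choice.inv \<tau>) [0..<m]"
  shows "\<sigma> = \<tau>"
proof -
  have "Hilbert_Choice.inv \<sigma> i = Hilbert_Choice.inv \<tau> i" for i
  proof (cases "i < m")
    case True
    then show ?thesis using assms(3) by auto
  next
    case False
    then show ?thesis
      using permutes_not_in [OF permutes_inv [OF assms(1)]] permutes_not_in [OF permutes_inv [OF assms(2)]]
      by simp
  qed
  then have "Hilbert_Choice.inv \<sigma> = Hilbert_Choice.inv \<tau>" by auto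
  then show ?thesis
    using assms by (metis permutes_inv_inv)
qed

text \<open>Bubble sort gives an expression of this length, and no expression is shorter because a
  swap adds at most one inversion.\<close>

lemma reduced_expression:
  assumes "\<sigma> permutes {..<m}"
  shows "is_expression m (reduced_expression m \<sigma>) \<sigma>"
    and "length (reduced_expression m \<sigma>) = inversions (map (Hilbert_Choice.inv \<sigma>) [0..<m])"
proof -
  have inv: "Hilbert_Choice.inv \<sigma> permutes {..<m}"
    by (rule permutes_inv [OF assms])
  have "distinct (map (Hilbert_Choice.inv \<sigma>) [0..<m])"
    using permutes_inj_on [OF inv] by (simp add: distinct_map)
  moreover have "set (map (Hilbert_Choice.inv \<sigma>) [0..<m]) = {..<m}"
    using permutes_image [OF inv] by (simp add: atLeast0LessThan)
  ultimately obtain ks where ks: "\<forall>k\<in>set ks. Suc k < m" "apply_swaps ks [0..<m] = map (Hilbert_Choice.inv \<sigma>) [0..<m]"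
    "length ks = inversions (map (Hilbert_Choice.inv \<sigma>) [0..<m])"
    using ex_reduced_swaps by blast
  have "\<sigma> = foldr (\<lambda>k \<tau>. transpose k (Suc k) \<circ> \<tau>) ks id"
    using apply_swaps_eq_map_inv [OF ks(1)] ks(2) by (intro permutes_eqI_map_inv [OF assms]) auto
  with ks have "is_expression m ks \<sigma>"
    by (simp add: is_expression_def)
  then have 1: "is_expression m (reduced_expression m \<sigma>) \<sigma>"
    and 2: "length (reduced_expression m \<sigma>) \<le> length ks"
    unfolding reduced_expression_def
    using arg_min_nat_lemma [of "\<lambda>ks. is_expression m ks \<sigma>" ks length] by auto
  from 1 show "is_expression m (reduced_expression m \<sigma>) \<sigma>" .
  then have "inversions (map (Hilbert_Choice.inv \<sigma>) [0..<m]) \<le> length (reduced_expression m \<sigma>)"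
    using apply_swaps_eq_map_inv(2) apply_swaps_upt(4) unfolding is_expression_def by metis
  with 2 ks(3) show "length (reduced_expression m \<sigma>) = inversions (map (Hilbert_Choice.inv \<sigma>) [0..<m])"
    by simp
qed

lemma braid_lift_eq_foldr: "braid_lift q m \<sigma> a = foldr (braiding_at q) (reduced_expression m \<sigma>) a"
proof -
  have "foldr (\<lambda>k f. braiding_at q k \<circ> f) ks id a = foldr (braiding_at q) ks a" for ks
    by (induct ks) auto
  then show ?thesis by (simp add: braid_lift_def)
qed

text \<open>The right-hand side depends on \<open>\<sigma>\<close> alone, whichever shortest
  expression \<open>ARG_MIN\<close> selects.\<close>

lemma braid_lift_word:
  assumes "\<sigma> permutes {..<m}"
  shows "braid_lift q m \<sigma> (word (map f [0..<m])) =
    tscale (inversion_coeff q f (map (Hilbert_Choice.inv \<sigma>) [0..<m])) (word (map f (map (Hilbert_Choice.inv \<sigma>) [0..<m])))"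
proof -
  let ?ks = "reduced_expression m \<sigma>"
  have ks: "\<forall>k\<in>set ?ks. Suc k < m" "apply_swaps ?ks [0..<m] = map (Hilbert_Choice.inv \<sigma>) [0..<m]"
    using reduced_expression(1) [OF assms] apply_swaps_eq_map_inv(2) [of ?ks m]
    by (auto simp: is_expression_def)
  then show ?thesis
    using apply_braidings_reduced [OF ks(1), of q f] reduced_expression(2) [OF assms]
    by (simp add: braid_lift_eq_foldr)
qed

section \<open>The sum over all permutations satisfies the shuffle recursion\<close>

definition permutation_sum :: "('n \<Rightarrow> 'n \<Rightarrow> 'a::field) \<Rightarrow> ('b::linorder \<Rightarrow> 'n) \<Rightarrow> 'b set \<Rightarrow> ('n, 'a) tensor" where
  "permutation_sum q f A = (\<Sum>xs\<in>permutations_of_set A. tscale (inversion_coeff q f xs) (word (map f xs)))"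

lemma bij_betw_permutes_permutations_of_set:
  "bij_betw (\<lambda>\<sigma>. map (Hilbert_Choice.inv \<sigma>) [0..<m]) {\<sigma>. \<sigma> permutes {..<m}} (permutations_of_set {..<m})"
proof -
  let ?h = "\<lambda>\<sigma>. map (Hilbert_Choice.inv \<sigma>) [0..<m]" and ?P = "{\<sigma>. \<sigma> permutes {..<m}}"
  have inj: "inj_on ?h ?P"
    by (auto intro!: inj_onI permutes_eqI_map_inv)
  have "?h \<sigma> \<in> permutations_of_set {..<m}" if "\<sigma> permutes {..<m}" for \<sigma>
    using permutes_image [OF permutes_inv [OF that]] permutes_inj_on [OF permutes_inv [OF that]]
    by (intro permutations_of_setI) (simp_all add: distinct_map atLeast0LessThan)
  then have "?h ` ?P \<subseteq> permutations_of_set {..<m}"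
    by auto
  moreover have "card (?h ` ?P) = card (permutations_of_set {..<m})"
    by (simp add: card_image [OF inj] card_permutations [of _ m])
  ultimately have "?h ` ?P = permutations_of_set {..<m}"
    by (intro card_subset_eq) auto
  with inj show ?thesis
    by (simp add: bij_betw_def)
qed

lemma quantum_symmetrizer_word:
  "quantum_symmetrizer q m (word (map f [0..<m])) = permutation_sum q f {..<m}"
proof -
  have "quantum_symmetrizer q m (word (map f [0..<m])) = (\<Sum>\<sigma> | \<sigma> permutes {..<m}.
    tscale (inversion_coeff q f (map (Hilbert_Choice.inv \<sigma>) [0..<m])) (word (map f (map (Hilbert_Choice.inv \<sigma>) [0..<m]))))"
    unfolding quantum_symmetrizer_def by (intro sum.cong) (auto simp: braid_lift_word)
  also have "\<dots> = permutation_sum q f {..<m}"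
    unfolding permutation_sum_def
    by (rule sum.reindex_bij_betw [OF bij_betw_permutes_permutations_of_set])
  finally show ?thesis .
qed

lemma word_mult_tscale_sum: "b * (\<Sum>x\<in>A. tscale (c x) (g x)) = (\<Sum>x\<in>A. tscale (c x) (b * g x))"
  by (simp add: sum_distrib_left tscale_mult_right)

text \<open>The permutations are sorted by their first entry \<open>x\<close>, which is inverted
  with the smaller elements of \<open>A\<close> in whatever order the rest comes. This recursion is
  the reason for admitting arbitrary sets of positions.\<close>

lemma permutation_sum_rec:
  assumes "finite A" "A \<noteq> {}"
  shows "permutation_sum q f A =
    (\<Sum>x\<in>A. tscale (\<Prod>y\<in>{y \<in> A. y < x}. q (f y) (f x)) (word [f x] * permutation_sum q f (A - {x})))"
proof -
  have "permutation_sum q f A =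
    (\<Sum>x\<in>A. \<Sum>xs\<in>Cons x ` permutations_of_set (A - {x}). tscale (inversion_coeff q f xs) (word (map f xs)))"
    unfolding permutation_sum_def
    by (subst permutations_of_set_nonempty [OF assms(2)], subst sum.UNION_disjoint) (use assms in auto)
  also have "\<dots> = (\<Sum>x\<in>A. \<Sum>xs\<in>permutations_of_set (A - {x}).
      tscale (inversion_coeff q f (x # xs)) (word (map f (x # xs))))"
    by (rule sum.cong [OF refl], subst sum.reindex) simp_all
  also have "\<dots> = (\<Sum>x\<in>A. tscale (\<Prod>y\<in>{y \<in> A. y < x}. q (f y) (f x)) (word [f x] * permutation_sum q f (A - {x})))"
  proof (intro sum.cong refl)
    fix x assume "x \<in> A"
    have "{y \<in> set xs. y < x} = {y \<in> A. y < x}" if "xs \<in> permutations_of_set (A - {x})" for xs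
      using permutations_of_setD(1) [OF that] by auto
    then have "(\<Sum>xs\<in>permutations_of_set (A - {x}). tscale (inversion_coeff q f (x # xs)) (word (map f (x # xs)))) =
      (\<Sum>xs\<in>permutations_of_set (A - {x}). tscale (\<Prod>y\<in>{y \<in> A. y < x}. q (f y) (f x))
        (tscale (inversion_coeff q f xs) (word [f x] * word (map f xs))))"
      by (intro sum.cong) (simp_all add: word_mult)
    then show "(\<Sum>xs\<in>permutations_of_set (A - {x}). tscale (inversion_coeff q f (x # xs)) (word (map f (x # xs)))) =
      tscale (\<Prod>y\<in>{y \<in> A. y < x}. q (f y) (f x)) (word [f x] * permutation_sum q f (A - {x}))"
      by (simp only: permutation_sum_def word_mult_tscale_sum tensor.scale_sum_right)
  qed
  finally show ?thesis .
qed

lemma shuffle_left_sum: "shuffle_left q i (\<Sum>x\<in>A. g x) = (\<Sum>x\<in>A. shuffle_left q i (g x))"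
  by (induct A rule: infinite_finite_induct) simp_all

text \<open>If \<open>z\<close> comes first, it causes no inversion; if \<open>x\<close> comes
  first, \<open>z\<close> adds the factor \<open>q (f z) (f x)\<close> and the induction hypothesis
  treats the rest. These are the two summands of \<open>shuffle_left_Cons\<close>.\<close>

lemma permutation_sum_insert_min:
  assumes "finite A" "\<forall>x\<in>A. z < x"
  shows "permutation_sum q f (insert z A) = shuffle_left q (f z) (permutation_sum q f A)"
  using assms
proof (induct "card A" arbitrary: A)
  case 0
  then have "A = {}" by simp
  then show ?case by (simp add: permutation_sum_def word_Nil)
next
  case (Suc n)
  then have A: "A \<noteq> {}" "z \<notin> A" by auto
  let ?c = "\<lambda>x. \<Prod>y\<in>{y \<in> A. y < x}. q (f y) (f x)"
  let ?S = "\<lambda>x. permutation_sum q f (A - {x})"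
  have "permutation_sum q f (insert z A) =
    tscale (\<Prod>y\<in>{y \<in> insert z A. y < z}. q (f y) (f z)) (word [f z] * permutation_sum q f (insert z A - {z})) +
    (\<Sum>x\<in>A. tscale (\<Prod>y\<in>{y \<in> insert z A. y < x}. q (f y) (f x)) (word [f x] * permutation_sum q f (insert z A - {x})))"
    using Suc.prems A by (subst permutation_sum_rec) auto
  also have "{y \<in> insert z A. y < z} = {}"
    using Suc.prems by auto
  also have "insert z A - {z} = A"
    using A by auto
  also have "(\<Sum>x\<in>A. tscale (\<Prod>y\<in>{y \<in> insert z A. y < x}. q (f y) (f x)) (word [f x] * permutation_sum q f (insert z A - {x})))
    = (\<Sum>x\<in>A. tscale (?c x) (tscale (q (f z) (f x)) (word [f x] * shuffle_left q (f z) (?S x))))"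
  proof (intro sum.cong refl)
    fix x assume x: "x \<in> A"
    have "{y \<in> insert z A. y < x} = insert z {y \<in> A. y < x}"
      using Suc.prems x by auto
    then have "(\<Prod>y\<in>{y \<in> insert z A. y < x}. q (f y) (f x)) = q (f z) (f x) * ?c x"
      using A Suc.prems by simp
    moreover have "insert z A - {x} = insert z (A - {x})"
      using A x by auto
    moreover have "permutation_sum q f (insert z (A - {x})) = shuffle_left q (f z) (?S x)"
      using Suc x by (intro Suc.hyps(1)) auto
    ultimately show "tscale (\<Prod>y\<in>{y \<in> insert z A. y < x}. q (f y) (f x)) (word [f x] * permutation_sum q f (insert z A - {x}))
      = tscale (?c x) (tscale (q (f z) (f x)) (word [f x] * shuffle_left q (f z) (?S x)))"
      by (simp add: mult.commute)
  qed
  also have "tscale (\<Prod>y\<in>{}. q (f y) (f z)) (word [f z] * permutation_sum q f A) =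
      (\<Sum>x\<in>A. tscale (?c x) (word [f z] * (word [f x] * ?S x)))"
    using permutation_sum_rec [OF \<open>finite A\<close> A(1), of q f] by (simp add: word_mult_tscale_sum)
  also have "(\<Sum>x\<in>A. tscale (?c x) (word [f z] * (word [f x] * ?S x))) +
      (\<Sum>x\<in>A. tscale (?c x) (tscale (q (f z) (f x)) (word [f x] * shuffle_left q (f z) (?S x)))) =
    (\<Sum>x\<in>A. tscale (?c x) (shuffle_left q (f z) (word [f x] * ?S x)))"
    by (simp add: shuffle_left_Cons tensor.scale_right_distrib sum.distrib)
  also have "\<dots> = shuffle_left q (f z) (permutation_sum q f A)"
    by (simp add: permutation_sum_rec [OF \<open>finite A\<close> A(1)] shuffle_left_sum)
  finally show ?case .
qed

lemma permutation_sum_upt: "permutation_sum q f {n..<m} = symmetrized_word q (map f [n..<m])"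
proof (induct "m - n" arbitrary: n)
  case 0
  then show ?case by (simp add: permutation_sum_def word_Nil)
next
  case (Suc d)
  then have "{n..<m} = insert n {Suc n..<m}" "[n..<m] = n # [Suc n..<m]"
    by (auto simp: upt_conv_Cons)
  moreover have "permutation_sum q f {Suc n..<m} = symmetrized_word q (map f [Suc n..<m])"
    using Suc by (intro Suc.hyps(1)) auto
  ultimately show ?case
    by (simp add: permutation_sum_insert_min)
qed

lemma quantum_symmetrizer_word_eq: "quantum_symmetrizer q (length w) (word w) = symmetrize q (word w)"
  using quantum_symmetrizer_word [of q "length w" "(!) w"] permutation_sum_upt [of q "(!) w" 0 "length w"]
  by (simp add: map_nth symmetrize_word atLeast0LessThan)

lemma quantum_symmetrizer_linear [simp]:
  "quantum_symmetrizer q m (a + b) = quantum_symmetrizer q m a + quantum_symmetrizer q m b"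
  "quantum_symmetrizer q m (tscale c a) = tscale c (quantum_symmetrizer q m a)"
  "quantum_symmetrizer q m 0 = 0"
proof -
  have "foldr (braiding_at q) ks (a + b) = foldr (braiding_at q) ks a + foldr (braiding_at q) ks b"
    "foldr (braiding_at q) ks (tscale c a) = tscale c (foldr (braiding_at q) ks a)"
    "foldr (braiding_at q) ks 0 = 0" for ks
    by (induct ks) simp_all
  then show "quantum_symmetrizer q m (a + b) = quantum_symmetrizer q m a + quantum_symmetrizer q m b"
    "quantum_symmetrizer q m (tscale c a) = tscale c (quantum_symmetrizer q m a)"
    "quantum_symmetrizer q m 0 = 0"
    by (simp_all add: quantum_symmetrizer_def braid_lift_eq_foldr sum.distrib tensor.scale_sum_right)
qed

lemma quantum_symmetrizer_eq_symmetrize: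
  assumes "a \<in> tensor_power m"
  shows "quantum_symmetrizer q m a = symmetrize q a"
proof -
  have "quantum_symmetrizer q m (\<Sum>w\<in>A. tscale (c w) (word w)) = symmetrize q (\<Sum>w\<in>A. tscale (c w) (word w))"
    if "\<forall>w\<in>A. length w = m" "finite A" for A c
    using that(2,1) by induct (auto simp: quantum_symmetrizer_word_eq)
  from this [of "Poly_Mapping.keys a" "Poly_Mapping.lookup a"] assms show ?thesis
    by (simp add: tensor_power_def flip: tensor_expansion)
qed

section \<open>The Nichols ideal as a kernel\<close>

definition hom_part :: "nat \<Rightarrow> ('n, 'a::field) tensor \<Rightarrow> ('n, 'a) tensor" where
  "hom_part m = linear_ext (\<lambda>w. if length w = m then word w else 0)"

lemma hom_part_linear [simp]:
  "hom_part m (a + b) = hom_part m a + hom_part m b"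
  "hom_part m (a - b) = hom_part m a - hom_part m b"
  "hom_part m (tscale c a) = tscale c (hom_part m a)"
  "hom_part m 0 = 0"
  by (simp_all add: hom_part_def)

lemma hom_part_word: "hom_part m (word w) = (if length w = m then word w else 0)"
  by (simp add: hom_part_def)

lemma hom_part_1: "hom_part m 1 = (if m = 0 then 1 else 0)"
  using hom_part_word [of m "[]"] by (simp only: word_Nil list.size eq_commute)

lemma lookup_hom_part:
  "Poly_Mapping.lookup (hom_part m a) w = (if length w = m then Poly_Mapping.lookup a w else 0)"
  by (induct a rule: tensor_induct) (auto simp: lookup_add hom_part_word lookup_word)

lemma hom_part_in_tensor_power: "hom_part m a \<in> tensor_power m"
  by (auto simp: tensor_power_def in_keys_iff lookup_hom_part split: if_splits)

lemma hom_part_tensor_power: "a \<in> tensor_power m \<Longrightarrow> hom_part m a = a"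
  by (rule poly_mapping_eqI) (auto simp: lookup_hom_part tensor_power_def in_keys_iff)

lemma hom_part_eq_0: "\<forall>w\<in>Poly_Mapping.keys a. length w < m \<Longrightarrow> hom_part m a = 0"
  by (rule poly_mapping_eqI) (auto simp: lookup_hom_part in_keys_iff)

lemma sum_hom_part: "(\<Sum>m\<in>length ` Poly_Mapping.keys a. hom_part m a) = a"
  by (rule poly_mapping_eqI) (auto simp: lookup_sum lookup_hom_part in_keys_iff sum.delta)

lemma hom_part_Cons:
  "hom_part (Suc m) (word [i] * a) = word [i] * hom_part m a"
  "hom_part 0 (word [i] * a) = 0"
  by (induct a rule: tensor_induct) (auto simp: tensor_simps word_mult hom_part_word)

lemma hom_part_shuffle_left:
  "hom_part (Suc m) (shuffle_left q i a) = shuffle_left q i (hom_part m a)"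
  "hom_part 0 (shuffle_left q i a) = 0"
proof -
  have "hom_part (Suc m) (shuffle_left q i (word w)) = shuffle_left q i (hom_part m (word w))
    \<and> hom_part 0 (shuffle_left q i (word w)) = 0" for w m
  proof (induct w arbitrary: m)
    case Nil
    show ?case by (simp add: shuffle_left_word_eq hom_part_word)
  next
    case (Cons y w)
    show ?case
    proof (cases m)
      case 0
      with Cons show ?thesis
        by (simp add: word_Cons [of y w] shuffle_left_Cons hom_part_Cons)
    next
      case (Suc m')
      with Cons [of m'] show ?thesis
        by (simp add: word_Cons [of y w] shuffle_left_Cons hom_part_Cons)
    qed
  qed
  then show "hom_part (Suc m) (shuffle_left q i a) = shuffle_left q i (hom_part m a)"
    "hom_part 0 (shuffle_left q i a) = 0"
    by (induct a rule: tensor_induct) simp_all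
qed

text \<open>\<open>symmetrize\<close> preserves the degree, since each insertion adds one
  letter.\<close>

lemma symmetrize_hom_part: "symmetrize q (hom_part m a) = hom_part m (symmetrize q a)"
proof -
  have "symmetrize q (hom_part m (word w)) = hom_part m (symmetrize q (word w))" for w
  proof (induct w arbitrary: m)
    case Nil
    show ?case by (simp add: word_Nil hom_part_1)
  next
    case (Cons y w)
    then show ?case
      by (cases m) (simp_all add: word_Cons [of y w] symmetrize_Cons hom_part_Cons hom_part_shuffle_left)
  qed
  then show ?thesis
    by (induct a rule: tensor_induct) simp_all
qed

text \<open>On the \<open>m\<close>-th tensor power \<open>symmetrize\<close> is the quantum
  symmetrizer, and the kernel of a graded map contains the homogeneous parts of its
  elements.\<close>

lemma nichols_ideal_eq: "nichols_ideal q = {a. symmetrize q a = 0}"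
proof
  have "tensor.subspace {a. symmetrize q a = 0}"
    unfolding symmetrize_def by (rule tensor_pair.linear_subspace_kernel [OF tlinear_linear_ext])
  then show "nichols_ideal q \<subseteq> {a. symmetrize q a = 0}"
    unfolding nichols_ideal_def by (intro tensor.span_minimal) (auto simp: quantum_symmetrizer_eq_symmetrize)
  show "{a. symmetrize q a = 0} \<subseteq> nichols_ideal q"
  proof
    fix a assume a: "a \<in> {a. symmetrize q a = 0}"
    have "hom_part m a \<in> nichols_ideal q" for m
    proof -
      have "quantum_symmetrizer q m (hom_part m a) = 0"
        using a by (simp add: quantum_symmetrizer_eq_symmetrize hom_part_in_tensor_power symmetrize_hom_part)
      then show ?thesis
        unfolding nichols_ideal_def using hom_part_in_tensor_power by (intro tensor.span_base) blast
    qed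
    then have "(\<Sum>m\<in>length ` Poly_Mapping.keys a. hom_part m a) \<in> nichols_ideal q"
      unfolding nichols_ideal_def by (intro tensor.span_sum)
    then show "a \<in> nichols_ideal q"
      by (simp add: sum_hom_part)
  qed
qed

lemma two_sided_ideal_nichols_ideal: "two_sided_ideal (nichols_ideal q)"
  by (simp add: two_sided_ideal_def nichols_ideal_eq symmetrize_eq_0_mult_left symmetrize_eq_0_mult_right)

section \<open>Twisting\<close>

text \<open>
  Any \<open>\<sigma>\<close> with \<open>\<sigma> j i * q i j = q' i j * \<sigma> i j\<close> could serve here; it exists because
  \<open>q' i j / q i j\<close> and \<open>q' j i / q j i\<close> are inverse to each other.
\<close>

definition twist_factor :: "('n::linorder \<Rightarrow> 'n \<Rightarrow> 'a::field) \<Rightarrow> ('n \<Rightarrow> 'n \<Rightarrow> 'a) \<Rightarrow> 'n \<Rightarrow> 'n \<Rightarrow> 'a" where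
  "twist_factor q q' i j = (if j < i then q' j i / q j i else 1)"

text \<open>One factor for each pair of positions; the product over a multiset counts repeated
  letters.\<close>

primrec twist_coeff :: "('n::linorder \<Rightarrow> 'n \<Rightarrow> 'a::field) \<Rightarrow> ('n \<Rightarrow> 'n \<Rightarrow> 'a) \<Rightarrow> 'n list \<Rightarrow> 'a" where
  "twist_coeff q q' [] = 1"
| "twist_coeff q q' (i # w) = (\<Prod>j\<in>#mset w. twist_factor q q' i j) * twist_coeff q q' w"

definition twist :: "('n::linorder \<Rightarrow> 'n \<Rightarrow> 'a::field) \<Rightarrow> ('n \<Rightarrow> 'n \<Rightarrow> 'a) \<Rightarrow> ('n, 'a) tensor \<Rightarrow> ('n, 'a) tensor" where
  "twist q q' = linear_ext (\<lambda>w. tscale (twist_coeff q q' w) (word w))"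

lemma twist_linear [simp]:
  "twist q q' (a + b) = twist q q' a + twist q q' b"
  "twist q q' (tscale c a) = tscale c (twist q q' a)"
  "twist q q' 0 = 0"
  by (simp_all add: twist_def)

context
  fixes q q' :: "'n::linorder \<Rightarrow> 'n \<Rightarrow> 'a::field"
  assumes nz: "\<And>i j. q i j \<noteq> 0" "\<And>i j. q' i j \<noteq> 0" and equiv: "twisting_equivalent q q'"
begin

text \<open>For \<open>i < j\<close> this is the definition of the factor; for \<open>j < i\<close>
  and for \<open>i = j\<close> it is the corresponding condition of twisting equivalence.\<close>

lemma twist_factor_flip: "twist_factor q q' j i * q i j = q' i j * twist_factor q q' i j"
proof -
  have "q i j * q j i = q' i j * q' j i" "q i i = q' i i"
    using equiv by (auto simp: twisting_equivalent_def)
  then show ?thesis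
    using nz by (cases i j rule: linorder_cases) (auto simp: twist_factor_def field_simps)
qed

text \<open>Only the factor of the exchanged pair changes. This makes \<open>twist\<close>
  intertwine the two braidings.\<close>

lemma twist_coeff_swap_at:
  "Suc k < length w \<Longrightarrow>
     twist_coeff q q' (swap_at k w) * q (w ! k) (w ! Suc k) = q' (w ! k) (w ! Suc k) * twist_coeff q q' w"
proof (induct k arbitrary: w)
  case 0
  then obtain i j v where "w = i # j # v"
    by (cases w; cases "tl w") auto
  then show ?case
    using twist_factor_flip [of j i] by (simp add: swap_at_def mult.assoc mult.left_commute mult.commute)
next
  case (Suc k)
  then obtain i v where "w = i # v"
    by (cases w) auto
  with Suc show ?case
    by (simp add: swap_at_Cons_Suc mult.assoc mult.left_commute)
qed

lemma twist_braiding_at: "twist q q' (braiding_at q k a) = braiding_at q' k (twist q q' a)"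
proof -
  have "twist q q' (braiding_at q k (word w)) = braiding_at q' k (twist q q' (word w))" for w
  proof (cases "Suc k < length w")
    case True
    then show ?thesis
      using twist_coeff_swap_at [of k w] by (simp add: braiding_at_word twist_def mult.commute)
  next
    case False
    then show ?thesis by (simp add: braiding_at_def twist_def)
  qed
  then show ?thesis
    by (induct a rule: tensor_induct) simp_all
qed

lemma twist_quantum_symmetrizer:
  "twist q q' (quantum_symmetrizer q m a) = quantum_symmetrizer q' m (twist q q' a)"
proof -
  have "twist q q' (foldr (braiding_at q) ks a) = foldr (braiding_at q') ks (twist q q' a)" for ks
    by (induct ks) (simp_all add: twist_braiding_at)
  moreover have "twist q q' (\<Sum>x\<in>A. g x) = (\<Sum>x\<in>A. twist q q' (g x))" for g and A :: "(nat \<Rightarrow> nat) set"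
    by (induct A rule: infinite_finite_induct) simp_all
  ultimately show ?thesis
    by (simp add: quantum_symmetrizer_def braid_lift_eq_foldr)
qed

lemma twist_coeff_nonzero: "twist_coeff q q' w \<noteq> 0"
  by (induct w) (use nz in \<open>auto simp: twist_factor_def prod_mset_zero_iff\<close>)

text \<open>A word is an eigenvector of \<open>twist\<close> with nonzero eigenvalue, so the
  intertwined symmetrizers annihilate it together.\<close>

lemma word_in_nichols_ideal_twist:
  assumes "word w \<in> nichols_ideal q"
  shows "word w \<in> nichols_ideal q'"
proof -
  have "quantum_symmetrizer q (length w) (word w) = 0"
    using assms by (simp add: nichols_ideal_eq quantum_symmetrizer_word_eq)
  then have "quantum_symmetrizer q' (length w) (twist q q' (word w)) = 0"
    by (metis twist_quantum_symmetrizer twist_linear(3))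
  then have "tscale (twist_coeff q q' w) (symmetrize q' (word w)) = 0"
    by (simp add: twist_def quantum_symmetrizer_word_eq)
  then show ?thesis
    using twist_coeff_nonzero by (simp add: nichols_ideal_eq tensor.scale_eq_0_iff)
qed

end

section \<open>The Nichols algebra as a quotient ring\<close>

lemma ring_tensor_algebra: "Ring.ring (tensor_algebra :: ('n, 'a::field) tensor ring)"
proof (rule ringI)
  show "abelian_group (tensor_algebra :: ('n, 'a) tensor ring)"
    by (rule abelian_groupI) (auto simp: tensor_algebra_def algebra_simps intro: exI [of _ "- x" for x])
  show "Group.monoid (tensor_algebra :: ('n, 'a) tensor ring)"
    by (rule monoidI) (auto simp: tensor_algebra_def mult.assoc)
qed (auto simp: tensor_algebra_def distrib_left distrib_right)

lemma ideal_nichols_ideal: "ideal (nichols_ideal q) tensor_algebra"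
proof (rule idealI [OF ring_tensor_algebra])
  interpret T: Ring.ring tensor_algebra by (rule ring_tensor_algebra)
  note J = two_sided_idealD [OF two_sided_ideal_nichols_ideal [of q]]
  show "subgroup (nichols_ideal q) (add_monoid tensor_algebra)"
  proof (rule T.add.subgroupI)
    show "nichols_ideal q \<noteq> {}" using J(1) by auto
    fix a assume a: "a \<in> nichols_ideal q"
    have "\<ominus>\<^bsub>tensor_algebra\<^esub> a = - a"
      by (rule T.minus_equality) (auto simp: tensor_algebra_def)
    with a show "\<ominus>\<^bsub>tensor_algebra\<^esub> a \<in> nichols_ideal q"
      by (simp add: J(5))
  qed (auto simp: tensor_algebra_def J)
qed (auto simp: tensor_algebra_def two_sided_idealD [OF two_sided_ideal_nichols_ideal])

lemma carrier_tensor_algebra [simp]: "carrier tensor_algebra = UNIV"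
  by (simp add: tensor_algebra_def)

lemma ring_nichols_algebra: "Ring.ring (nichols_algebra q)"
  unfolding nichols_algebra_def by (rule ideal.quotient_is_ring [OF ideal_nichols_ideal])

lemma to_nichols_ring_hom: "to_nichols q \<in> ring_hom tensor_algebra (nichols_algebra q)"
  using ideal.rcos_ring_hom [OF ideal_nichols_ideal, of q]
  unfolding nichols_algebra_def to_nichols_def by simp

lemma to_nichols_mult: "to_nichols q a \<otimes>\<^bsub>nichols_algebra q\<^esub> to_nichols q b = to_nichols q (a * b)"
  using ring_hom_mult [OF to_nichols_ring_hom, of a b q] by (simp add: tensor_algebra_def)

lemma to_nichols_add: "to_nichols q a \<oplus>\<^bsub>nichols_algebra q\<^esub> to_nichols q b = to_nichols q (a + b)"
  using ring_hom_add [OF to_nichols_ring_hom, of a b q] by (simp add: tensor_algebra_def)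

lemma to_nichols_one: "\<one>\<^bsub>nichols_algebra q\<^esub> = to_nichols q 1"
  using ring_hom_one [OF to_nichols_ring_hom, of q] by (simp add: tensor_algebra_def)

lemma to_nichols_carrier: "to_nichols q a \<in> carrier (nichols_algebra q)"
  using ring_hom_closed [OF to_nichols_ring_hom, of a q] by simp

lemma to_nichols_zero: "\<zero>\<^bsub>nichols_algebra q\<^esub> = to_nichols q 0"
  using ring_hom_zero [OF to_nichols_ring_hom ring_tensor_algebra ring_nichols_algebra, of q]
  by (simp add: tensor_algebra_def)

lemma to_nichols_uminus: "\<ominus>\<^bsub>nichols_algebra q\<^esub> to_nichols q a = to_nichols q (- a)"
proof -
  interpret B: Ring.ring "nichols_algebra q" by (rule ring_nichols_algebra)
  show ?thesis
    by (rule B.minus_equality) (auto simp: to_nichols_add to_nichols_carrier to_nichols_zero)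
qed

lemma to_nichols_minus: "to_nichols q a \<ominus>\<^bsub>nichols_algebra q\<^esub> to_nichols q b = to_nichols q (a - b)"
  by (simp add: a_minus_def to_nichols_uminus to_nichols_add)

lemma carrier_nichols_algebra: "carrier (nichols_algebra q) = range (to_nichols q)"
  by (auto simp: nichols_algebra_def FactRing_def A_RCOSETS_defs to_nichols_def a_r_coset_def)

lemma to_nichols_eq_iff: "to_nichols q a = to_nichols q b \<longleftrightarrow> a - b \<in> nichols_ideal q"
proof -
  interpret I: ideal "nichols_ideal q" tensor_algebra by (rule ideal_nichols_ideal)
  have "to_nichols q c = to_nichols q 0 \<longleftrightarrow> c \<in> nichols_ideal q" for c
    using I.a_rcos_const [of c] I.a_rcos_self [of c] to_nichols_zero [of q]
    by (auto simp: to_nichols_def nichols_algebra_def FactRing_def)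
  moreover have "to_nichols q a = to_nichols q b \<longleftrightarrow> to_nichols q (a - b) = to_nichols q 0"
  proof
    assume "to_nichols q a = to_nichols q b"
    then show "to_nichols q (a - b) = to_nichols q 0"
      using to_nichols_add [of q a "- b"] to_nichols_add [of q b "- b"] by simp
  next
    assume "to_nichols q (a - b) = to_nichols q 0"
    then show "to_nichols q a = to_nichols q b"
      using to_nichols_add [of q "a - b" b] to_nichols_add [of q 0 b] by simp
  qed
  ultimately show ?thesis by simp
qed

text \<open>This opens the dimension theory over the scalars. They embed faithfully because
  \<open>symmetrize\<close> fixes them.\<close>

lemma subfield_nichols_scalars:
  fixes q :: "'n \<Rightarrow> 'n \<Rightarrow> 'a::field"
  shows "subfield (nichols_scalars q) (nichols_algebra q)"
proof -
  interpret B: Ring.ring "nichols_algebra q" by (rule ring_nichols_algebra)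
  have scalar: "to_nichols q (tscale c 1) \<in> nichols_scalars q" for c
    by (auto simp: nichols_scalars_def)
  have eq_0: "to_nichols q (tscale c 1) = \<zero>\<^bsub>nichols_algebra q\<^esub> \<longleftrightarrow> c = 0" for c
    by (simp add: to_nichols_zero to_nichols_eq_iff nichols_ideal_eq tensor.scale_eq_0_iff)
  have one: "\<one>\<^bsub>nichols_algebra q\<^esub> = to_nichols q (tscale 1 1)"
    by (simp add: to_nichols_one)
  have mult: "to_nichols q (tscale c 1) \<otimes>\<^bsub>nichols_algebra q\<^esub> to_nichols q (tscale d 1)
    = to_nichols q (tscale (c * d) 1)" for c d
    by (simp add: to_nichols_mult tscale_mult_left)
  have sub: "subring (nichols_scalars q) (nichols_algebra q)"
  proof (rule B.subringI)
    show "nichols_scalars q \<subseteq> carrier (nichols_algebra q)"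
      by (auto simp: nichols_scalars_def to_nichols_carrier)
    show "\<one>\<^bsub>nichols_algebra q\<^esub> \<in> nichols_scalars q"
      unfolding one by (rule scalar)
  next
    fix x assume "x \<in> nichols_scalars q"
    then show "\<ominus>\<^bsub>nichols_algebra q\<^esub> x \<in> nichols_scalars q"
      using scalar by (auto simp: nichols_scalars_def to_nichols_uminus simp flip: tensor.scale_minus_left)
  next
    fix x y assume "x \<in> nichols_scalars q" "y \<in> nichols_scalars q"
    then obtain c d where xy: "x = to_nichols q (tscale c 1)" "y = to_nichols q (tscale d 1)"
      by (auto simp: nichols_scalars_def)
    show "x \<otimes>\<^bsub>nichols_algebra q\<^esub> y \<in> nichols_scalars q"
      by (simp add: xy mult scalar)
    show "x \<oplus>\<^bsub>nichols_algebra q\<^esub> y \<in> nichols_scalars q"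
      by (simp add: xy to_nichols_add scalar flip: tensor.scale_left_distrib)
  qed
  have "subcring (nichols_scalars q) (nichols_algebra q)"
    by (rule B.subcringI [OF sub]) (auto simp: nichols_scalars_def mult mult.commute)
  moreover have "Units (nichols_algebra q\<lparr>carrier := nichols_scalars q\<rparr>) = nichols_scalars q - {\<zero>\<^bsub>nichols_algebra q\<^esub>}"
  proof
    show "Units (nichols_algebra q\<lparr>carrier := nichols_scalars q\<rparr>) \<subseteq> nichols_scalars q - {\<zero>\<^bsub>nichols_algebra q\<^esub>}"
    proof
      fix x assume "x \<in> Units (nichols_algebra q\<lparr>carrier := nichols_scalars q\<rparr>)"
      then obtain y where x: "x \<in> nichols_scalars q" and "y \<in> nichols_scalars q"
        and "x \<otimes>\<^bsub>nichols_algebra q\<^esub> y = \<one>\<^bsub>nichols_algebra q\<^esub>"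
        by (auto simp: Units_def)
      then obtain c d where c: "x = to_nichols q (tscale c 1)" and "to_nichols q (tscale (c * d) 1) = \<one>\<^bsub>nichols_algebra q\<^esub>"
        by (auto simp: nichols_scalars_def mult)
      then have "tscale (c * d) 1 - 1 \<in> nichols_ideal q"
        by (simp add: to_nichols_one to_nichols_eq_iff)
      then have "tscale (c * d - 1) (1 :: ('n, 'a) tensor) = 0"
        by (simp add: nichols_ideal_eq tensor.scale_left_diff_distrib)
      then have "c \<noteq> 0"
        by (auto simp: tensor.scale_eq_0_iff)
      with c x show "x \<in> nichols_scalars q - {\<zero>\<^bsub>nichols_algebra q\<^esub>}"
        by (simp add: eq_0)
    qed
    show "nichols_scalars q - {\<zero>\<^bsub>nichols_algebra q\<^esub>} \<subseteq> Units (nichols_algebra q\<lparr>carrier := nichols_scalars q\<rparr>)"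
    proof
      fix x assume x: "x \<in> nichols_scalars q - {\<zero>\<^bsub>nichols_algebra q\<^esub>}"
      then obtain c where c: "x = to_nichols q (tscale c 1)" "c \<noteq> 0"
        using eq_0 by (auto simp: nichols_scalars_def)
      then have "x \<otimes>\<^bsub>nichols_algebra q\<^esub> to_nichols q (tscale (inverse c) 1) = \<one>\<^bsub>nichols_algebra q\<^esub>"
        "to_nichols q (tscale (inverse c) 1) \<otimes>\<^bsub>nichols_algebra q\<^esub> x = \<one>\<^bsub>nichols_algebra q\<^esub>"
        by (simp_all add: mult to_nichols_one)
      then show "x \<in> Units (nichols_algebra q\<lparr>carrier := nichols_scalars q\<rparr>)"
        using x scalar by (auto simp: Units_def)
    qed
  qed
  ultimately show ?thesis
    by (rule B.subfieldI)
qed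

lemma to_nichols_tscale:
  "to_nichols q (tscale c 1) \<otimes>\<^bsub>nichols_algebra q\<^esub> to_nichols q a = to_nichols q (tscale c a)"
  by (simp add: to_nichols_mult tscale_mult_left)

section \<open>Finite dimension\<close>

text \<open>Finitely many spanning elements have representatives of bounded degree; the bound is
  built up along the dimension.\<close>

lemma nichols_finite_dim_bounded:
  assumes "nichols_finite_dim q E"
  shows "\<exists>N. \<forall>x\<in>E. \<exists>a. x = to_nichols q a \<and> (\<forall>w\<in>Poly_Mapping.keys a. length w < N)"
proof -
  interpret B: Ring.ring "nichols_algebra q" by (rule ring_nichols_algebra)
  obtain n where "B.dimension n (nichols_scalars q) E"
    using assms by (auto simp: nichols_finite_dim_def B.finite_dimension_def)
  then show ?thesis
  proof (induct n "nichols_scalars q" E)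
    case zero_dim
    show ?case
      by (auto simp: to_nichols_zero intro!: exI [of _ 0])
  next
    case (Suc_dim v E n)
    then obtain N where N: "\<forall>x\<in>E. \<exists>a. x = to_nichols q a \<and> (\<forall>w\<in>Poly_Mapping.keys a. length w < N)"
      by blast
    obtain b where b: "v = to_nichols q b"
      using Suc_dim(1) by (auto simp: carrier_nichols_algebra)
    have "finite (length ` Poly_Mapping.keys b)"
      by simp
    then obtain M where M: "\<forall>w\<in>Poly_Mapping.keys b. length w < M"
      unfolding finite_nat_set_iff_bounded by blast
    show ?case
    proof (intro exI [of _ "max M N"] ballI)
      fix x assume "x \<in> B.line_extension (nichols_scalars q) v E"
      then obtain c y where y: "y \<in> E"
        and x: "x = to_nichols q (tscale c 1) \<otimes>\<^bsub>nichols_algebra q\<^esub> v \<oplus>\<^bsub>nichols_algebra q\<^esub> y"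
        by (auto simp: B.line_extension_mem_iff nichols_scalars_def)
      obtain a where a: "y = to_nichols q a" "\<forall>w\<in>Poly_Mapping.keys a. length w < N"
        using N y by blast
      have "x = to_nichols q (tscale c b + a)"
        by (simp add: x a(1) b to_nichols_tscale to_nichols_add)
      moreover have "Poly_Mapping.keys (tscale c b + a) \<subseteq> Poly_Mapping.keys b \<union> Poly_Mapping.keys a"
        by (auto simp: in_keys_iff lookup_add)
      ultimately show "\<exists>a. x = to_nichols q a \<and> (\<forall>w\<in>Poly_Mapping.keys a. length w < max M N)"
        using M a(2) by (intro exI [of _ "tscale c b + a"]) (auto simp: less_max_iff_disj)
    qed
  qed
qed

text \<open>An element of large degree \<open>m\<close> has a representative of smaller degree. The
  ideal is homogeneous, so it contains the part of degree \<open>m\<close> of their difference,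
  which is the element itself.\<close>

lemma nichols_finite_dim_tensor_power:
  assumes "nichols_finite_dim q E"
  shows "\<exists>N. \<forall>m\<ge>N. \<forall>a\<in>tensor_power m. to_nichols q a \<in> E \<longrightarrow> a \<in> nichols_ideal q"
proof -
  obtain N where N: "\<forall>x\<in>E. \<exists>a. x = to_nichols q a \<and> (\<forall>w\<in>Poly_Mapping.keys a. length w < N)"
    using nichols_finite_dim_bounded [OF assms] by blast
  have "a \<in> nichols_ideal q" if m: "N \<le> m" and a: "a \<in> tensor_power m" "to_nichols q a \<in> E" for m a
  proof -
    obtain b where b: "to_nichols q a = to_nichols q b" "\<forall>w\<in>Poly_Mapping.keys b. length w < N"
      using N a(2) by metis
    have "symmetrize q (hom_part m (a - b)) = 0"
      unfolding symmetrize_hom_part using b(1) by (simp add: to_nichols_eq_iff nichols_ideal_eq)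
    moreover have "hom_part m b = 0"
      using m b(2) by (intro hom_part_eq_0) auto
    then have "hom_part m (a - b) = a"
      by (simp add: hom_part_tensor_power [OF a(1)])
    ultimately have "symmetrize q a = 0"
      by metis
    then show ?thesis
      by (simp add: nichols_ideal_eq)
  qed
  then show ?thesis by blast
qed

lemma word_in_tensor_power: "word w \<in> tensor_power (length w)"
  by (simp add: tensor_power_def word_def)

text \<open>If all words of length \<open>s\<close> vanish, so do the longer ones, as multiples of
  their prefixes; finitely many words remain as a spanning set.\<close>

lemma nichols_finite_dim_carrier_iff:
  fixes q :: "'n::finite \<Rightarrow> 'n \<Rightarrow> 'a::field"
  shows "nichols_finite_dim q (carrier (nichols_algebra q)) \<longleftrightarrow>
    (\<exists>s. \<forall>w. length w = s \<longrightarrow> word w \<in> nichols_ideal q)"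
proof
  assume "nichols_finite_dim q (carrier (nichols_algebra q))"
  then obtain N where "\<forall>m\<ge>N. \<forall>a\<in>tensor_power m.
      to_nichols q a \<in> carrier (nichols_algebra q) \<longrightarrow> a \<in> nichols_ideal q"
    using nichols_finite_dim_tensor_power by blast
  then have "\<forall>w. length w = N \<longrightarrow> word w \<in> nichols_ideal q"
    using word_in_tensor_power to_nichols_carrier by (metis order_refl)
  then show "\<exists>s. \<forall>w. length w = s \<longrightarrow> word w \<in> nichols_ideal q" ..
next
  assume "\<exists>s. \<forall>w. length w = s \<longrightarrow> word w \<in> nichols_ideal q"
  then obtain s where s: "\<And>w. length w = s \<Longrightarrow> word w \<in> nichols_ideal q"
    by blast
  interpret B: Ring.ring "nichols_algebra q" by (rule ring_nichols_algebra)
  have "finite {w :: 'n list. set w \<subseteq> UNIV \<and> length w \<le> s}"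
    by (rule finite_lists_length_le) simp
  then obtain ws where ws: "set ws = {w :: 'n list. length w \<le> s}"
    using finite_list by auto
  let ?Us = "map (\<lambda>w. to_nichols q (word w)) ws"
  let ?S = "B.Span (nichols_scalars q) ?Us"
  have Us: "set ?Us \<subseteq> carrier (nichols_algebra q)"
    by (auto simp: to_nichols_carrier)
  note props = B.Span_subgroup_props [OF subfield_nichols_scalars Us]
  have word: "to_nichols q (word w) \<in> ?S" for w
  proof (cases "length w \<le> s")
    case True
    then have "to_nichols q (word w) \<in> set ?Us"
      by (auto simp: ws)
    then show ?thesis
      using B.Span_base_incl [OF subfield_nichols_scalars Us] by blast
  next
    case False
    then have "word (take s w) * word (drop s w) \<in> nichols_ideal q"
      by (intro two_sided_idealD(4) [OF two_sided_ideal_nichols_ideal] s) simp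
    then have "to_nichols q (word w) = \<zero>\<^bsub>nichols_algebra q\<^esub>"
      by (simp add: word_mult to_nichols_zero to_nichols_eq_iff)
    then show ?thesis
      using props(2) by simp
  qed
  have "to_nichols q a \<in> ?S" for a
  proof (induct a rule: tensor_induct)
    case zero
    then show ?case using props(2) by (simp add: to_nichols_zero)
  next
    case (add a c w)
    have "to_nichols q (tscale c 1) \<otimes>\<^bsub>nichols_algebra q\<^esub> to_nichols q (word w) \<in> ?S"
      by (rule B.Span_smult_closed [OF subfield_nichols_scalars Us _ word]) (auto simp: nichols_scalars_def)
    with add show ?case
      using props(3) by (simp add: to_nichols_tscale flip: to_nichols_add)
  qed
  then have "?S = carrier (nichols_algebra q)"
    using props(1) by (auto simp: carrier_nichols_algebra)
  then show "nichols_finite_dim q (carrier (nichols_algebra q))"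
    using B.Span_finite_dimension [OF subfield_nichols_scalars Us]
    by (simp add: nichols_finite_dim_def)
qed

section \<open>The Nichols Lie algebra\<close>

lemma subalgebra_nichols_lie: "subalgebra (nichols_scalars q) (nichols_lie q) (nichols_algebra q)"
proof -
  interpret B: Ring.ring "nichols_algebra q" by (rule ring_nichols_algebra)
  let ?F = "{L. subalgebra (nichols_scalars q) L (nichols_algebra q) \<and>
     (\<forall>i. to_nichols q (word [i]) \<in> L) \<and> (\<forall>a\<in>L. \<forall>b\<in>L. nichols_commutator q a b \<in> L)}"
  have "nichols_scalars q \<subseteq> carrier (nichols_algebra q)"
    by (rule subfieldE(3) [OF subfield_nichols_scalars])
  \<comment> \<open>The whole algebra is a member, so the intersection is over a nonempty
    family.\<close>
  then have "carrier (nichols_algebra q) \<in> ?F"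
    by (auto simp: B.carrier_is_subalgebra to_nichols_carrier nichols_commutator_def)
  then have "?F \<noteq> {}" by blast
  moreover have "subgroup L (add_monoid (nichols_algebra q))" if "L \<in> ?F" for L
    using that subalgebra.axioms(1) by blast
  ultimately have "subgroup (\<Inter>?F) (add_monoid (nichols_algebra q))"
    by (intro B.add.subgroups_Inter) auto
  moreover have "subalgebra_axioms (nichols_scalars q) (\<Inter>?F) (nichols_algebra q)"
    by (auto simp: subalgebra_axioms_def dest: subalgebra.smult_closed)
  ultimately show ?thesis
    unfolding nichols_lie_def by (rule subalgebra.intro)
qed

lemma nichols_lie_commutator:
  "a \<in> nichols_lie q \<Longrightarrow> b \<in> nichols_lie q \<Longrightarrow> nichols_commutator q a b \<in> nichols_lie q"
  by (simp add: nichols_lie_def)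

lemma left_normed_in_nichols_lie: "a \<in> left_normed d \<Longrightarrow> to_nichols q a \<in> nichols_lie q"
proof (induct d arbitrary: a)
  case 0
  then show ?case by (auto simp: nichols_lie_def)
next
  case (Suc d)
  then obtain i b where a: "a = word [i] * b - b * word [i]" and b: "b \<in> left_normed d"
    by auto
  have "to_nichols q (word [i]) \<in> nichols_lie q"
    by (auto simp: nichols_lie_def)
  moreover have "to_nichols q b \<in> nichols_lie q"
    by (rule Suc.hyps [OF b])
  moreover have "nichols_commutator q (to_nichols q (word [i])) (to_nichols q b) = to_nichols q a"
    by (simp add: nichols_commutator_def to_nichols_mult to_nichols_minus a)
  ultimately show ?case
    using nichols_lie_commutator by metis
qed

lemma tensor_power_mult: "a \<in> tensor_power m \<Longrightarrow> b \<in> tensor_power n \<Longrightarrow> a * b \<in> tensor_power (m + n)"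
  using keys_mult [of a b] by (fastforce simp: tensor_power_def plus_list_def)

lemma left_normed_tensor_power: "(left_normed d :: ('n, 'a::field) tensor set) \<subseteq> tensor_power (Suc d)"
proof (induct d)
  case 0
  then show ?case by (auto simp: tensor_power_def word_def)
next
  case (Suc d)
  have "word [i] * a - a * word [i] \<in> tensor_power (Suc (Suc d))" if "a \<in> left_normed d" for i and a :: "('n, 'a) tensor"
  proof -
    have "a \<in> tensor_power (Suc d)"
      using Suc that by blast
    then have "word [i] * a \<in> tensor_power (Suc (Suc d))" "a * word [i] \<in> tensor_power (Suc (Suc d))"
      using tensor_power_mult word_in_tensor_power [of "[i]"] by fastforce+
    then show ?thesis
      by (auto simp: tensor_power_def in_keys_iff lookup_minus)
  qed
  then show ?case by auto
qed

text \<open>The first edge of a path from \<open>i\<close> to any other vertex.\<close>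

lemma connected_ex_neighbour:
  fixes q :: "'n::finite \<Rightarrow> 'n \<Rightarrow> 'a::field"
  assumes "card (UNIV :: 'n set) > 1" "connected_braiding q"
  shows "\<exists>j. j \<noteq> i \<and> q i j * q j i \<noteq> 1"
proof -
  have "UNIV \<noteq> {i}"
  proof
    assume "UNIV = {i}"
    then have "card (UNIV :: 'n set) = card {i}" by (rule arg_cong)
    with assms(1) show False by simp
  qed
  then obtain k where "k \<noteq> i" by blast
  have "(i, k) \<in> {(k, l). k \<noteq> l \<and> q k l * q l k \<noteq> 1}\<^sup>*"
    using assms(2) by (auto simp: connected_braiding_def)
  then show ?thesis
    using \<open>k \<noteq> i\<close> by (cases rule: converse_rtranclE) auto
qed

text \<open>One direction is passage to a subspace. In the other, deep commutators vanish for
  reasons of degree; with a neighbour \<open>j\<close> of \<open>i\<close> this yields nilpotency of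
  each letter, and \<open>words_in_ideal\<close> applies.\<close>

theorem nichols_finite_dim_iff_lie:
  fixes q :: "'n::finite \<Rightarrow> 'n \<Rightarrow> 'a::field_char_0"
  assumes "card (UNIV :: 'n set) > 1" "connected_braiding q"
  shows "nichols_finite_dim q (carrier (nichols_algebra q)) \<longleftrightarrow> nichols_finite_dim q (nichols_lie q)"
proof
  interpret B: Ring.ring "nichols_algebra q" by (rule ring_nichols_algebra)
  show "nichols_finite_dim q (nichols_lie q)" if "nichols_finite_dim q (carrier (nichols_algebra q))"
    using that B.subalbegra_incl_imp_finite_dimension [OF subfield_nichols_scalars _ subalgebra_nichols_lie]
      B.subalgebra_in_carrier [OF subalgebra_nichols_lie]
    by (simp add: nichols_finite_dim_def)
  assume "nichols_finite_dim q (nichols_lie q)"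
  then obtain N where N: "\<And>m a. N \<le> m \<Longrightarrow> a \<in> tensor_power m \<Longrightarrow> to_nichols q a \<in> nichols_lie q \<Longrightarrow>
      a \<in> nichols_ideal q"
    using nichols_finite_dim_tensor_power by blast
  have left_normed: "left_normed d \<subseteq> nichols_ideal q" if "N \<le> d" for d
  proof
    fix a :: "('n, 'a) tensor" assume "a \<in> left_normed d"
    then show "a \<in> nichols_ideal q"
      using that left_normed_tensor_power [of d] left_normed_in_nichols_lie by (intro N [of "Suc d"]) auto
  qed
  have "\<exists>m. word [i] ^ m \<in> nichols_ideal q" for i
  proof -
    obtain j where j: "i \<noteq> j" "q i j * q j i \<noteq> 1"
      using connected_ex_neighbour [OF assms] by metis
    have "((\<lambda>a. word [i] * a - a * word [i]) ^^ k) (word [j]) \<in> (left_normed k :: ('n, 'a) tensor set)" for k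
      by (induct k) auto
    with left_normed [of N] have "symmetrize q (((\<lambda>a. word [i] * a - a * word [i]) ^^ N) (word [j])) = 0"
      by (auto simp: nichols_ideal_eq)
    then have "symmetrize q (word (replicate N i)) = 0"
      by (rule symmetrize_replicate_eq_0 [of i j q N, OF j])
    moreover have "word [i] ^ k = (word (replicate k i) :: ('n, 'a) tensor)" for k
      by (induct k) (simp_all add: word_Nil word_mult)
    ultimately show ?thesis
      by (auto simp: nichols_ideal_eq intro!: exI [of _ N])
  qed
  then show "nichols_finite_dim q (carrier (nichols_algebra q))"
    unfolding nichols_finite_dim_carrier_iff
    by (rule words_in_ideal [OF two_sided_ideal_nichols_ideal _ left_normed])
qed

theorem theorem4p8:
  fixes q :: "'n::{finite,linorder} \<Rightarrow> 'n \<Rightarrow> 'a::field_char_0"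
  assumes rank: "card (UNIV :: 'n set) > 1"
    and nonzero: "\<And>i j. q i j \<noteq> 0"
    and connected: "connected_braiding q"
    and arithmetic: "arithmetic_root_system q"
    and no_infinity_element: "\<not> (\<exists>m u. infinity_element q m u)"
    and not_one: "\<And>u. u \<in> hard_super_letters q \<Longrightarrow> self_braiding q u \<noteq> 1"
  shows "(\<not> nichols_finite_dim q (carrier (nichols_algebra q)) \<longleftrightarrow>
           (\<exists>q' :: 'n \<Rightarrow> 'n \<Rightarrow> 'a. (\<forall>i j. q' i j \<noteq> 0) \<and> twisting_equivalent q q' \<and>
              \<not> nichols_finite_dim q' (nichols_lie q')))
       \<and> ((\<forall>i. \<exists>j. j \<noteq> i \<and> q j i \<noteq> 1) \<longrightarrow>
           (nichols_finite_dim q (carrier (nichols_algebra q)) \<longleftrightarrow>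
            nichols_finite_dim q (nichols_lie q)))"
proof -
  have iff: "nichols_finite_dim q (carrier (nichols_algebra q)) \<longleftrightarrow> nichols_finite_dim q (nichols_lie q)"
    by (rule nichols_finite_dim_iff_lie [OF rank connected])
  \<comment> \<open>This is the contrapositive of the implication from right to left in (i); for the
    converse, \<open>q\<close> itself serves as \<open>q'\<close>.\<close>
  have "nichols_finite_dim q' (nichols_lie q')"
    if fin: "nichols_finite_dim q (carrier (nichols_algebra q))"
      and q': "\<forall>i j. q' i j \<noteq> 0" "twisting_equivalent q q'" for q' :: "'n \<Rightarrow> 'n \<Rightarrow> 'a"
  proof -
    \<comment> \<open>The edges depend only on the products \<open>q i j * q j i\<close>, which
      twisting equivalence preserves.\<close>
    have "connected_braiding q'"
      using connected q'(2) by (simp add: connected_braiding_def twisting_equivalent_def)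
    moreover have "word w \<in> nichols_ideal q'" if "word w \<in> nichols_ideal q" for w
      using word_in_nichols_ideal_twist [OF nonzero _ q'(2) that] q'(1) by blast
    then have "nichols_finite_dim q' (carrier (nichols_algebra q'))"
      using fin unfolding nichols_finite_dim_carrier_iff by blast
    ultimately show ?thesis
      using nichols_finite_dim_iff_lie [OF rank] by blast
  qed
  moreover have "twisting_equivalent q q"
    by (simp add: twisting_equivalent_def)
  ultimately show ?thesis
    using iff nonzero by blast
qed

end
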